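(* Let $K$ be any field. The Lie algebra $\mathfrak{sl}_{fr}(\mathbb{N},K)$ and the factor Lie algebra $\mathfrak{gl}_{cf}(\mathbb{N},K)/\bigl(\mathfrak{d}_{sc}(\mathbb{N},K)\oplus\mathfrak{gl}_{fr}(\mathbb{N},K)\bigr)$ are simple.
   Context: $\mathbb{N}$ denotes the positive integers and $K$ is a field. $\mathfrak{gl}_{cf}(\mathbb{N},K)$ is the set of all $\mathbb{N}\times\mathbb{N}$ matrices over $K$ having only finitely many nonzero entries in each column, regarded as a Lie algebra over $K$ with $[A,B]=AB-BA$. $E$ is the infinite identity matrix and $\mathfrak{d}_{sc}(\mathbb{N},K)=\{\alpha E:\alpha\in K\}$. $\mathfrak{gl}_{fr}(\mathbb{N},K)$ is the subalgebra of those matrices in $\mathfrak{gl}_{cf}(\mathbb{N},K)$ that have nonzero entries in only finitely many rows. For $A=(a_{ij})\in\mathfrak{gl}_{fr}(\mathbb{N},K)$ the trace is $\mathrm{Tr}(A)=\sum_i a_{ii}$ (a finite sum), and $\mathfrak{sl}_{fr}(\mathbb{N},K)=\{A\in\mathfrak{gl}_{fr}(\mathbb{N},K):\mathrm{Tr}(A)=0\}$. The symbol $\oplus$ denotes the internal direct sum inside $\mathfrak{gl}_{cf}(\mathbb{N},K)$; the subspace $\mathfrak{d}_{sc}(\mathbb{N},K)\oplus\mathfrak{gl}_{fr}(\mathbb{N},K)$ is an ideal of $\mathfrak{gl}_{cf}(\mathbb{N},K)$. *)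

theory Defs
  imports Main
begin

section \<open>Lie algebras over a field\<close>

record ('k, 'v) lie_structure =
  lie_carrier :: "'v set"
  lie_zero :: 'v
  lie_add :: "'v \<Rightarrow> 'v \<Rightarrow> 'v"
  lie_scale :: "'k \<Rightarrow> 'v \<Rightarrow> 'v"
  lie_bracket :: "'v \<Rightarrow> 'v \<Rightarrow> 'v"

locale lie_algebra =
  fixes L :: "('k::field, 'v) lie_structure"
  assumes zero_closed: "lie_zero L \<in> lie_carrier L"
    and add_closed:
      "\<lbrakk>x \<in> lie_carrier L; y \<in> lie_carrier L\<rbrakk> \<Longrightarrow> lie_add L x y \<in> lie_carrier L"
    and scale_closed: "x \<in> lie_carrier L \<Longrightarrow> lie_scale L a x \<in> lie_carrier L"
    and bracket_closed:
      "\<lbrakk>x \<in> lie_carrier L; y \<in> lie_carrier L\<rbrakk> \<Longrightarrow> lie_bracket L x y \<in> lie_carrier L"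
    and add_assoc:
      "\<lbrakk>x \<in> lie_carrier L; y \<in> lie_carrier L; z \<in> lie_carrier L\<rbrakk>
        \<Longrightarrow> lie_add L (lie_add L x y) z = lie_add L x (lie_add L y z)"
    and add_commute:
      "\<lbrakk>x \<in> lie_carrier L; y \<in> lie_carrier L\<rbrakk> \<Longrightarrow> lie_add L x y = lie_add L y x"
    and add_zero: "x \<in> lie_carrier L \<Longrightarrow> lie_add L (lie_zero L) x = x"
    and add_inverse: "x \<in> lie_carrier L \<Longrightarrow> \<exists>y\<in>lie_carrier L. lie_add L x y = lie_zero L"
    and scale_add_right:
      "\<lbrakk>x \<in> lie_carrier L; y \<in> lie_carrier L\<rbrakk>
        \<Longrightarrow> lie_scale L a (lie_add L x y) = lie_add L (lie_scale L a x) (lie_scale L a y)"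
    and scale_add_left:
      "x \<in> lie_carrier L
        \<Longrightarrow> lie_scale L (a + b) x = lie_add L (lie_scale L a x) (lie_scale L b x)"
    and scale_scale:
      "x \<in> lie_carrier L \<Longrightarrow> lie_scale L a (lie_scale L b x) = lie_scale L (a * b) x"
    and scale_one: "x \<in> lie_carrier L \<Longrightarrow> lie_scale L 1 x = x"
    and bracket_add_left:
      "\<lbrakk>x \<in> lie_carrier L; y \<in> lie_carrier L; z \<in> lie_carrier L\<rbrakk>
        \<Longrightarrow> lie_bracket L (lie_add L x y) z = lie_add L (lie_bracket L x z) (lie_bracket L y z)"
    and bracket_add_right:
      "\<lbrakk>x \<in> lie_carrier L; y \<in> lie_carrier L; z \<in> lie_carrier L\<rbrakk>
        \<Longrightarrow> lie_bracket L x (lie_add L y z) = lie_add L (lie_bracket L x y) (lie_bracket L x z)"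
    and bracket_scale_left:
      "\<lbrakk>x \<in> lie_carrier L; y \<in> lie_carrier L\<rbrakk>
        \<Longrightarrow> lie_bracket L (lie_scale L a x) y = lie_scale L a (lie_bracket L x y)"
    and bracket_scale_right:
      "\<lbrakk>x \<in> lie_carrier L; y \<in> lie_carrier L\<rbrakk>
        \<Longrightarrow> lie_bracket L x (lie_scale L a y) = lie_scale L a (lie_bracket L x y)"
    and bracket_self: "x \<in> lie_carrier L \<Longrightarrow> lie_bracket L x x = lie_zero L"
    and jacobi:
      "\<lbrakk>x \<in> lie_carrier L; y \<in> lie_carrier L; z \<in> lie_carrier L\<rbrakk>
        \<Longrightarrow> lie_add L (lie_bracket L x (lie_bracket L y z))
              (lie_add L (lie_bracket L y (lie_bracket L z x))
                (lie_bracket L z (lie_bracket L x y))) = lie_zero L"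

definition lie_subspace :: "('k::field, 'v) lie_structure \<Rightarrow> 'v set \<Rightarrow> bool" where
  "lie_subspace L S \<longleftrightarrow>
     S \<subseteq> lie_carrier L \<and> lie_zero L \<in> S \<and>
     (\<forall>x\<in>S. \<forall>y\<in>S. lie_add L x y \<in> S) \<and> (\<forall>a. \<forall>x\<in>S. lie_scale L a x \<in> S)"

definition lie_ideal :: "('k::field, 'v) lie_structure \<Rightarrow> 'v set \<Rightarrow> bool" where
  "lie_ideal L I \<longleftrightarrow>
     lie_subspace L I \<and> (\<forall>x\<in>lie_carrier L. \<forall>y\<in>I. lie_bracket L x y \<in> I)"

definition simple_lie_algebra :: "('k::field, 'v) lie_structure \<Rightarrow> bool" where
  "simple_lie_algebra L \<longleftrightarrow>
     lie_algebra L \<and>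
     (\<exists>x\<in>lie_carrier L. \<exists>y\<in>lie_carrier L. lie_bracket L x y \<noteq> lie_zero L) \<and>
     (\<forall>I. lie_ideal L I \<longrightarrow> I = {lie_zero L} \<or> I = lie_carrier L)"

definition lie_restrict ::
    "('k, 'v) lie_structure \<Rightarrow> 'v set \<Rightarrow> ('k, 'v) lie_structure" where
  "lie_restrict L S = L\<lparr>lie_carrier := S\<rparr>"

definition lie_sum :: "('k, 'v) lie_structure \<Rightarrow> 'v set \<Rightarrow> 'v set \<Rightarrow> 'v set" where
  "lie_sum L S T = {lie_add L x y |x y. x \<in> S \<and> y \<in> T}"

definition lie_coset :: "('k, 'v) lie_structure \<Rightarrow> 'v set \<Rightarrow> 'v \<Rightarrow> 'v set" where
  "lie_coset L I x = {lie_add L x z |z. z \<in> I}"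

text \<open>
  Each operation on cosets is the union, over all choices of representatives, of the resulting
  cosets.  For an ideal \<open>I\<close> these all coincide, so the union is a single coset.
\<close>

definition lie_quotient ::
    "('k, 'v) lie_structure \<Rightarrow> 'v set \<Rightarrow> ('k, 'v set) lie_structure" where
  "lie_quotient L I =
    \<lparr>lie_carrier = lie_coset L I ` lie_carrier L,
     lie_zero = lie_coset L I (lie_zero L),
     lie_add = (\<lambda>X Y. \<Union>x\<in>X. \<Union>y\<in>Y. lie_coset L I (lie_add L x y)),
     lie_scale = (\<lambda>a X. \<Union>x\<in>X. lie_coset L I (lie_scale L a x)),
     lie_bracket = (\<lambda>X Y. \<Union>x\<in>X. \<Union>y\<in>Y. lie_coset L I (lie_bracket L x y))\<rparr>"


section \<open>Column-finite infinite matrices\<close>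

text \<open>Rows and columns are numbered from 0 instead of from 1.\<close>

type_synonym 'k inf_mat = "nat \<Rightarrow> nat \<Rightarrow> 'k"

text \<open>
  The index set contains the support of column \<open>j\<close> of \<open>B\<close>; it is finite when \<open>B\<close> is column-finite,
  and the terms left out vanish.
\<close>

definition mat_mult :: "'k::field inf_mat \<Rightarrow> 'k inf_mat \<Rightarrow> 'k inf_mat" where
  "mat_mult A B = (\<lambda>i j. \<Sum>k | B k j \<noteq> 0. A i k * B k j)"

definition gl_cf :: "('k::field, 'k inf_mat) lie_structure" where
  "gl_cf =
    \<lparr>lie_carrier = {A. \<forall>j. finite {i. A i j \<noteq> 0}},
     lie_zero = (\<lambda>i j. 0),
     lie_add = (\<lambda>A B i j. A i j + B i j),
     lie_scale = (\<lambda>a A i j. a * A i j),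
     lie_bracket = (\<lambda>A B i j. mat_mult A B i j - mat_mult B A i j)\<rparr>"

definition d_sc :: "'k::field inf_mat set" where
  "d_sc = {(\<lambda>i j. a * (if i = j then 1 else 0)) |a. True}"

definition gl_fr :: "'k::field inf_mat set" where
  "gl_fr = {A \<in> lie_carrier gl_cf. finite {i. \<exists>j. A i j \<noteq> 0}}"

definition trace_fr :: "'k::field inf_mat \<Rightarrow> 'k" where
  "trace_fr A = (\<Sum>i | A i i \<noteq> 0. A i i)"

definition sl_fr :: "'k::field inf_mat set" where
  "sl_fr = {A \<in> gl_fr. trace_fr A = 0}"

text \<open>The sum of \<^const>\<open>d_sc\<close> and \<^const>\<open>gl_fr\<close> is direct, and it is an ideal.\<close>

lemma d_sc_Int_gl_fr: "d_sc \<inter> gl_fr = {lie_zero (gl_cf :: ('k::field, 'k inf_mat) lie_structure)}"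
proof -
  have "a = 0" if "(\<lambda>i j. a * (if i = j then 1 else 0 :: 'k)) \<in> gl_fr" for a
  proof (rule ccontr)
    assume "a \<noteq> 0"
    then have "{i. \<exists>j. a * (if i = j then 1 else 0 :: 'k) \<noteq> 0} = (UNIV :: nat set)"
      by auto
    with that show False
      unfolding gl_fr_def by simp
  qed
  then have "d_sc \<inter> gl_fr \<subseteq> {lie_zero (gl_cf :: ('k, 'k inf_mat) lie_structure)}"
    by (force simp: d_sc_def gl_cf_def)
  moreover have "lie_zero gl_cf \<in> (d_sc :: 'k inf_mat set)"
    by (force simp: d_sc_def gl_cf_def)
  moreover have "lie_zero gl_cf \<in> (gl_fr :: 'k inf_mat set)"
    by (simp add: gl_fr_def gl_cf_def)
  ultimately show ?thesis by blast
qed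

lemma mat_mult_eq_sum:
  assumes "finite S" "{k. B k j \<noteq> 0} \<subseteq> S"
  shows "mat_mult A B i j = (\<Sum>k\<in>S. A i k * B k j)"
  unfolding mat_mult_def by (rule sum.mono_neutral_left) (use assms in auto)

lemma gl_fr_bracket:
  fixes A F :: "'k::field inf_mat"
  assumes A: "A \<in> lie_carrier gl_cf" and F: "F \<in> gl_fr"
  shows "lie_bracket gl_cf A F \<in> gl_fr"
proof -
  define R where "R = {i. \<exists>j. F i j \<noteq> 0}"
  have R: "finite R" using F by (simp add: R_def gl_fr_def)
  have cA: "finite {i. A i k \<noteq> 0}" for k using A by (simp add: gl_cf_def)
  define T where "T = R \<union> (\<Union>k\<in>R. {i. A i k \<noteq> 0})"
  have T: "finite T" using R cA by (simp add: T_def)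
  have 0: "lie_bracket gl_cf A F i j = 0" if "i \<notin> T" for i j
  proof -
    have "mat_mult A F i j = 0"
      unfolding mat_mult_def by (rule sum.neutral) (use that in \<open>auto simp: T_def R_def\<close>)
    moreover have "mat_mult F A i j = 0"
      unfolding mat_mult_def by (rule sum.neutral) (use that in \<open>auto simp: T_def R_def\<close>)
    ultimately show ?thesis by (simp add: gl_cf_def)
  qed
  have "finite {i. \<exists>j. lie_bracket gl_cf A F i j \<noteq> 0}"
    by (rule finite_subset[OF _ T]) (use 0 in blast)
  moreover have "finite {i. lie_bracket gl_cf A F i j \<noteq> 0}" for j
    by (rule finite_subset[OF _ T]) (use 0 in blast)
  moreover have "lie_carrier (gl_cf :: ('k, 'k inf_mat) lie_structure) = {A. \<forall>j. finite {i. A i j \<noteq> 0}}"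
    by (simp add: gl_cf_def)
  ultimately show ?thesis unfolding gl_fr_def by simp
qed

lemma lie_subspace_gl_fr: "lie_subspace gl_cf (gl_fr :: 'k::field inf_mat set)"
proof -
  have "finite {i. \<exists>j. A i j + B i j \<noteq> 0}"
    if "finite {i. \<exists>j. A i j \<noteq> 0}" "finite {i. \<exists>j. B i j \<noteq> 0}" for A B :: "'k inf_mat"
    by (rule finite_subset[OF _ finite_UnI[OF that]]) force
  moreover have "finite {i. A i j + B i j \<noteq> 0}"
    if "finite {i. A i j \<noteq> 0}" "finite {i. B i j \<noteq> 0}" for A B :: "'k inf_mat" and j
    by (rule finite_subset[OF _ finite_UnI[OF that]]) force
  moreover have "finite {i. \<exists>j. a * A i j \<noteq> 0}"
    if "finite {i. \<exists>j. A i j \<noteq> 0}" for a and A :: "'k inf_mat"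
    by (rule finite_subset[OF _ that]) auto
  moreover have "finite {i. a * A i j \<noteq> 0}"
    if "finite {i. A i j \<noteq> 0}" for a j and A :: "'k inf_mat"
    by (rule finite_subset[OF _ that]) auto
  ultimately show ?thesis
    by (simp add: lie_subspace_def gl_fr_def gl_cf_def subset_iff)
qed

lemma lie_ideal_d_sc_gl_fr:
  "lie_ideal gl_cf (lie_sum gl_cf d_sc gl_fr :: 'k::field inf_mat set)"
proof -
  define D :: "'k \<Rightarrow> 'k inf_mat" where "D a = (\<lambda>i j. a * (if i = j then 1 else 0))" for a
  let ?G = "gl_cf :: ('k, 'k inf_mat) lie_structure"
  have I: "lie_sum ?G d_sc gl_fr = {lie_add ?G (D a) F |a F. F \<in> gl_fr}"
    by (auto simp: lie_sum_def d_sc_def D_def)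
  have carr: "lie_carrier ?G = {A. \<forall>j. finite {i. A i j \<noteq> 0}}" by (simp add: gl_cf_def)
  have fr: "lie_zero ?G \<in> gl_fr" "\<And>F H. \<lbrakk>F \<in> gl_fr; H \<in> gl_fr\<rbrakk> \<Longrightarrow> lie_add ?G F H \<in> gl_fr"
    "\<And>a F. F \<in> gl_fr \<Longrightarrow> lie_scale ?G a F \<in> gl_fr" "gl_fr \<subseteq> lie_carrier ?G"
    using lie_subspace_gl_fr[where ?'k = 'k] unfolding lie_subspace_def by auto
  have fin: "finite {i. lie_add ?G (D a) F i j \<noteq> 0}" if F: "F \<in> gl_fr" for a F j
  proof -
    have "finite (insert j {i. F i j \<noteq> 0})" using F fr(4) carr by auto
    then show ?thesis by (rule rev_finite_subset) (auto simp: gl_cf_def D_def)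
  qed
  have br: "lie_bracket ?G A (lie_add ?G (D a) F) = lie_bracket ?G A F"
    if A: "A \<in> lie_carrier ?G" and F: "F \<in> gl_fr" for A a F
  proof (intro ext)
    fix i j
    let ?S = "insert j {k. F k j \<noteq> 0}"
    let ?T = "insert i {k. A k j \<noteq> 0}"
    have S: "finite ?S" using F fr(4) carr by auto
    have T: "finite ?T" using A carr by auto
    have D1: "(\<Sum>k\<in>?S. A i k * D a k j) = A i j * a"
    proof -
      have "(\<Sum>k\<in>?S. A i k * D a k j) = (\<Sum>k\<in>?S. if k = j then A i k * a else 0)"
        by (rule sum.cong) (auto simp: D_def)
      then show ?thesis using S by (simp add: sum.delta)
    qed
    have D2: "(\<Sum>k\<in>?T. D a i k * A k j) = a * A i j"
    proof -
      have "(\<Sum>k\<in>?T. D a i k * A k j) = (\<Sum>k\<in>?T. if k = i then a * A k j else 0)"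
        by (rule sum.cong) (auto simp: D_def)
      then show ?thesis using T by (simp add: sum.delta)
    qed
    have "mat_mult A (lie_add ?G (D a) F) i j = (\<Sum>k\<in>?S. A i k * lie_add ?G (D a) F k j)"
      by (rule mat_mult_eq_sum[OF S]) (auto simp: gl_cf_def D_def)
    also have "\<dots> = (\<Sum>k\<in>?S. A i k * D a k j) + (\<Sum>k\<in>?S. A i k * F k j)"
      by (simp only: sum.distrib[symmetric]) (simp add: gl_cf_def algebra_simps)
    also have "(\<Sum>k\<in>?S. A i k * F k j) = mat_mult A F i j"
      by (rule mat_mult_eq_sum[OF S, symmetric]) auto
    finally have 1: "mat_mult A (lie_add ?G (D a) F) i j = A i j * a + mat_mult A F i j"
      using D1 by simp
    have "mat_mult (lie_add ?G (D a) F) A i j = (\<Sum>k\<in>?T. lie_add ?G (D a) F i k * A k j)"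
      by (rule mat_mult_eq_sum[OF T]) auto
    also have "\<dots> = (\<Sum>k\<in>?T. D a i k * A k j) + (\<Sum>k\<in>?T. F i k * A k j)"
      by (simp only: sum.distrib[symmetric]) (simp add: gl_cf_def algebra_simps)
    also have "(\<Sum>k\<in>?T. F i k * A k j) = mat_mult F A i j"
      by (rule mat_mult_eq_sum[OF T, symmetric]) auto
    finally have 2: "mat_mult (lie_add ?G (D a) F) A i j = a * A i j + mat_mult F A i j"
      using D2 by simp
    have eq: "lie_bracket ?G X Y i j = mat_mult X Y i j - mat_mult Y X i j" for X Y
      by (simp add: gl_cf_def)
    show "lie_bracket ?G A (lie_add ?G (D a) F) i j = lie_bracket ?G A F i j"
      using 1 2 by (simp add: eq)
  qed
  have in_I: "X \<in> lie_sum ?G d_sc gl_fr" if "X = lie_add ?G (D a) F" "F \<in> gl_fr" for X a F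
    using that I by blast
  show ?thesis
    unfolding lie_ideal_def lie_subspace_def
  proof (intro conjI ballI allI)
    show "lie_sum ?G d_sc gl_fr \<subseteq> lie_carrier ?G"
      using fin by (auto simp: I carr)
    show "lie_zero ?G \<in> lie_sum ?G d_sc gl_fr"
      by (rule in_I[where a = 0 and F = "lie_zero ?G"]) (use fr(1) in \<open>auto simp: gl_cf_def D_def\<close>)
  next
    fix X Y assume "X \<in> lie_sum ?G d_sc gl_fr" "Y \<in> lie_sum ?G d_sc gl_fr"
    then obtain a F b H where XY: "X = lie_add ?G (D a) F" "F \<in> gl_fr"
      "Y = lie_add ?G (D b) H" "H \<in> gl_fr" unfolding I by blast
    show "lie_add ?G X Y \<in> lie_sum ?G d_sc gl_fr"
      by (rule in_I[where a = "a + b" and F = "lie_add ?G F H"])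
        (use XY fr(2) in \<open>auto simp: gl_cf_def D_def algebra_simps\<close>)
  next
    fix c X assume "X \<in> lie_sum ?G d_sc gl_fr"
    then obtain a F where X: "X = lie_add ?G (D a) F" "F \<in> gl_fr" unfolding I by blast
    show "lie_scale ?G c X \<in> lie_sum ?G d_sc gl_fr"
      by (rule in_I[where a = "c * a" and F = "lie_scale ?G c F"])
        (use X fr(3) in \<open>auto simp: gl_cf_def D_def algebra_simps\<close>)
  next
    fix A X assume A: "A \<in> lie_carrier ?G" and "X \<in> lie_sum ?G d_sc gl_fr"
    then obtain a F where X: "X = lie_add ?G (D a) F" "F \<in> gl_fr" unfolding I by blast
    have "lie_bracket ?G A X = lie_bracket ?G A F" using br A X by simp
    moreover have "lie_bracket ?G A F = lie_add ?G (D 0) (lie_bracket ?G A F)"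
      by (simp add: gl_cf_def D_def)
    ultimately show "lie_bracket ?G A X \<in> lie_sum ?G d_sc gl_fr"
      using gl_fr_bracket[OF A X(2)] in_I by metis
  qed
qed

end

theory Submission
  imports Defs "HOL-Library.Infinite_Set"
begin

text \<open>
  Column-finite matrices are the endomorphisms of a vector space of countable dimension, matrices
  with finitely many nonzero rows are the endomorphisms of finite rank, and the bracket is the
  commutator of an associative ring.  Both simplicity proofs start from one element of an ideal
  and produce every other element by explicit commutators, without dividing by any integer, so
  that no characteristic is special.

  The quotient.  An ideal of the quotient pulls back to an ideal \<open>J\<close> of all column-finite matrices,
  and it suffices that one \<open>a \<in> J\<close> that is not scalar plus finite-row forces \<open>J\<close> to be everything.
  First, \<open>a\<close> or its commutator with the shift has nonzero off-diagonal entries in infinitely many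
  rows: if \<open>a\<close> does not, it is diagonal up to finitely many rows, and the commutator with the shift
  records the differences of consecutive diagonal entries.  Next, column-finiteness lets one
  choose disjoint infinite families of rows and columns on which \<open>a\<close> restricts to an upper
  triangular matrix with nonzero diagonal (\<open>triangular_submatrix\<close>), and such a matrix has a
  column-finite left inverse.  This gives \<open>s\<close> and \<open>t\<close> with \<open>t a s = 1\<close> and \<open>t s = 0\<close>, for which a
  double commutator of \<open>a\<close> is \<open>- s (y z + z y) t\<close> (\<open>corner_mem\<close>).  Every column-finite matrix is an
  anticommutator as well as a commutator, since the equation \<open>d z - e z d = x\<close> with \<open>d\<close> the shift
  can be solved row by row.  Hence \<open>J\<close> contains a whole off-diagonal block of a
  decomposition of the index set into three infinite parts.  Matrix units between the parts
  carry this block to the other off-diagonal ones, and commutators of those fill the diagonal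
  blocks (\<open>eq_UNIV_if_block\<close>).

  The trace-zero finite-row matrices.  A nonzero element \<open>a\<close> has only finitely many nonzero rows, so
  bracketing it with matrix units at fresh indices isolates a single entry and leaves a matrix
  unit \<open>e\<^sub>m\<^sub>l\<close> with \<open>m \<noteq> l\<close> in the ideal.  From it one obtains all matrices with a single nonzero row and
  zero diagonal, then the differences of diagonal matrix units, and these span
  (\<open>trace_zero_decomposition\<close>).
\<close>

section \<open>Subalgebras and quotients of Lie algebras\<close>

context lie_algebra
begin

lemma zero_add_right: "x \<in> lie_carrier L \<Longrightarrow> lie_add L x (lie_zero L) = x"
  using add_commute add_zero zero_closed by metis

lemma add_left_commute:
  assumes "x \<in> lie_carrier L" "y \<in> lie_carrier L" "z \<in> lie_carrier L"
  shows "lie_add L x (lie_add L y z) = lie_add L y (lie_add L x z)"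
  using assms by (metis add_assoc add_commute)

lemma add_self_eq_zero:
  assumes x: "x \<in> lie_carrier L" and "lie_add L x x = x"
  shows "x = lie_zero L"
proof -
  obtain y where y: "y \<in> lie_carrier L" "lie_add L x y = lie_zero L"
    using add_inverse x by blast
  have "lie_add L (lie_add L x x) y = x"
    using x y by (simp add: add_assoc zero_add_right)
  then show ?thesis using assms(2) y by simp
qed

lemma scale_zero: "x \<in> lie_carrier L \<Longrightarrow> lie_scale L 0 x = lie_zero L"
  by (rule add_self_eq_zero) (simp_all add: scale_closed flip: scale_add_left)

lemma add_minus: "x \<in> lie_carrier L \<Longrightarrow> lie_add L x (lie_scale L (-1) x) = lie_zero L"
  using scale_add_left[of x 1 "-1"] by (simp add: scale_one scale_zero)

text \<open>
  In characteristic 2 antisymmetry is weaker than the vanishing of \<open>[x, x]\<close>; it follows from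
  the latter by expanding \<open>[x + y, x + y] = 0\<close>.
\<close>

lemma bracket_antisym:
  assumes x: "x \<in> lie_carrier L" and y: "y \<in> lie_carrier L"
  shows "lie_bracket L y x = lie_scale L (-1) (lie_bracket L x y)"
proof -
  let ?a = "lie_bracket L x y" and ?b = "lie_bracket L y x"
  have c: "?a \<in> lie_carrier L" "?b \<in> lie_carrier L" "lie_scale L (-1) ?a \<in> lie_carrier L"
    using x y by (auto intro: bracket_closed scale_closed)
  have "lie_zero L = lie_bracket L (lie_add L x y) (lie_add L x y)"
    using x y by (simp add: bracket_self add_closed)
  also have "\<dots> = lie_add L (lie_bracket L x (lie_add L x y)) (lie_bracket L y (lie_add L x y))"
    using x y by (intro bracket_add_left add_closed)
  also have "\<dots> = lie_add L ?a ?b"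
    using x y c by (simp add: bracket_add_right bracket_self add_zero zero_add_right)
  finally have ab: "lie_add L ?a ?b = lie_zero L" ..
  have "?b = lie_add L (lie_add L ?a (lie_scale L (-1) ?a)) ?b"
    using c by (simp add: add_minus add_zero)
  also have "\<dots> = lie_add L (lie_scale L (-1) ?a) (lie_add L ?a ?b)"
    using c by (simp add: add_assoc add_left_commute)
  also have "\<dots> = lie_scale L (-1) ?a" using c ab by (simp add: zero_add_right)
  finally show ?thesis .
qed

lemma lie_algebra_restrict:
  assumes S: "lie_subspace L S"
    and br: "\<And>x y. x \<in> S \<Longrightarrow> y \<in> S \<Longrightarrow> lie_bracket L x y \<in> S"
  shows "lie_algebra (lie_restrict L S)"
proof -
  have sub: "x \<in> lie_carrier L" if "x \<in> S" for x
    using S that by (auto simp: lie_subspace_def)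
  have ops: "lie_zero L \<in> S" "\<And>x y. x \<in> S \<Longrightarrow> y \<in> S \<Longrightarrow> lie_add L x y \<in> S"
    "\<And>a x. x \<in> S \<Longrightarrow> lie_scale L a x \<in> S"
    using S by (auto simp: lie_subspace_def)
  have inv: "\<exists>y\<in>S. lie_add L x y = lie_zero L" if "x \<in> S" for x
    using add_minus[OF sub[OF that]] ops(3)[OF that] by blast
  show ?thesis
    by unfold_locales
      (auto simp: lie_restrict_def sub ops br inv add_assoc add_zero scale_add_left
        scale_add_right scale_scale scale_one bracket_add_left bracket_add_right
        bracket_scale_left bracket_scale_right bracket_self jacobi intro: add_commute[OF sub sub])
qed

end

lemma UN_eq_if_constant:
  assumes "x \<in> A" "\<And>u. u \<in> A \<Longrightarrow> f u = C"
  shows "(\<Union>u\<in>A. f u) = C"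
  using assms by auto

locale lie_algebra_ideal = lie_algebra L for L :: "('k::field, 'v) lie_structure" +
  fixes I
  assumes ideal: "lie_ideal L I"
begin

abbreviation "cl \<equiv> lie_coset L I"
abbreviation "Q \<equiv> lie_quotient L I"

lemma ideal_sub: "x \<in> I \<Longrightarrow> x \<in> lie_carrier L"
  and ideal_zero: "lie_zero L \<in> I"
  and ideal_add: "x \<in> I \<Longrightarrow> y \<in> I \<Longrightarrow> lie_add L x y \<in> I"
  and ideal_scale: "x \<in> I \<Longrightarrow> lie_scale L a x \<in> I"
  and ideal_bracket: "x \<in> lie_carrier L \<Longrightarrow> y \<in> I \<Longrightarrow> lie_bracket L x y \<in> I"
  using ideal by (auto simp: lie_ideal_def lie_subspace_def)

lemma ideal_bracket': "x \<in> I \<Longrightarrow> y \<in> lie_carrier L \<Longrightarrow> lie_bracket L x y \<in> I"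
  by (subst bracket_antisym) (auto intro: ideal_scale ideal_bracket ideal_sub)

lemma mem_coset: "y \<in> cl x \<longleftrightarrow> (\<exists>z\<in>I. y = lie_add L x z)"
  by (auto simp: lie_coset_def)

lemma self_mem_coset: "x \<in> lie_carrier L \<Longrightarrow> x \<in> cl x"
  using ideal_zero zero_add_right by (auto simp: mem_coset intro!: bexI[of _ "lie_zero L"])

text \<open>
  This makes the operations on cosets independent of the representatives: changing the arguments
  by elements of the ideal changes each result by an element of the ideal.
\<close>

lemma coset_add_ideal:
  assumes x: "x \<in> lie_carrier L" and z: "z \<in> I"
  shows "cl (lie_add L x z) = cl x"
proof
  show "cl (lie_add L x z) \<subseteq> cl x"
  proof
    fix y assume "y \<in> cl (lie_add L x z)"
    then obtain w where "w \<in> I" "y = lie_add L (lie_add L x z) w" by (auto simp: mem_coset)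
    then have "y = lie_add L x (lie_add L z w)" "lie_add L z w \<in> I"
      using x z by (auto simp: add_assoc ideal_sub ideal_add)
    then show "y \<in> cl x" by (auto simp: mem_coset)
  qed
  show "cl x \<subseteq> cl (lie_add L x z)"
  proof
    fix y assume "y \<in> cl x"
    then obtain w where w: "w \<in> I" "y = lie_add L x w" by (auto simp: mem_coset)
    let ?m = "lie_scale L (-1) z"
    have "lie_add L (lie_add L x z) (lie_add L ?m w) = lie_add L x (lie_add L (lie_add L z ?m) w)"
      using x z w by (simp add: add_assoc ideal_sub ideal_scale ideal_add)
    also have "\<dots> = y" using z w by (simp add: add_minus ideal_sub add_zero)
    finally show "y \<in> cl (lie_add L x z)"
      using z w by (auto simp: mem_coset intro!: bexI[of _ "lie_add L ?m w"] ideal_add ideal_scale)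
  qed
qed

lemma coset_eq: "x \<in> lie_carrier L \<Longrightarrow> y \<in> cl x \<Longrightarrow> cl y = cl x"
  using coset_add_ideal by (auto simp: mem_coset)

lemma coset_eq_zero_iff:
  assumes x: "x \<in> lie_carrier L" shows "cl x = cl (lie_zero L) \<longleftrightarrow> x \<in> I"
proof
  assume "cl x = cl (lie_zero L)"
  then have "x \<in> cl (lie_zero L)" using self_mem_coset x by blast
  then show "x \<in> I" by (auto simp: mem_coset add_zero ideal_sub)
next
  assume "x \<in> I"
  then have "x \<in> cl (lie_zero L)" by (auto simp: mem_coset add_zero ideal_sub intro!: bexI[of _ x])
  then show "cl x = cl (lie_zero L)" by (simp add: coset_eq zero_closed)
qed

lemma quot_carrier: "lie_carrier Q = cl ` lie_carrier L"
  and quot_zero: "lie_zero Q = cl (lie_zero L)"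
  by (simp_all add: lie_quotient_def)

lemma quot_add:
  assumes x: "x \<in> lie_carrier L" and y: "y \<in> lie_carrier L"
  shows "lie_add Q (cl x) (cl y) = cl (lie_add L x y)"
proof -
  have "cl (lie_add L u v) = cl (lie_add L x y)" if uv: "u \<in> cl x" "v \<in> cl y" for u v
  proof -
    obtain z w where "z \<in> I" "w \<in> I" "u = lie_add L x z" "v = lie_add L y w"
      using uv by (auto simp: mem_coset)
    then have "lie_add L u v = lie_add L (lie_add L x y) (lie_add L z w)" "lie_add L z w \<in> I"
      using x y by (auto simp: add_assoc add_left_commute add_closed ideal_sub ideal_add)
    then show ?thesis using x y by (simp add: coset_add_ideal add_closed)
  qed
  then show ?thesis
    unfolding lie_quotient_def lie_structure.simps
    by (intro UN_eq_if_constant[OF self_mem_coset[OF x]] UN_eq_if_constant[OF self_mem_coset[OF y]])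
qed

lemma quot_scale:
  assumes x: "x \<in> lie_carrier L"
  shows "lie_scale Q a (cl x) = cl (lie_scale L a x)"
proof -
  have "cl (lie_scale L a u) = cl (lie_scale L a x)" if u: "u \<in> cl x" for u
  proof -
    obtain z where "z \<in> I" "u = lie_add L x z"
      using u by (auto simp: mem_coset)
    then show ?thesis using x
      by (simp add: scale_add_right ideal_sub coset_add_ideal scale_closed ideal_scale)
  qed
  then show ?thesis
    unfolding lie_quotient_def lie_structure.simps by (rule UN_eq_if_constant[OF self_mem_coset[OF x]])
qed

lemma quot_bracket:
  assumes x: "x \<in> lie_carrier L" and y: "y \<in> lie_carrier L"
  shows "lie_bracket Q (cl x) (cl y) = cl (lie_bracket L x y)"
proof -
  have "cl (lie_bracket L u v) = cl (lie_bracket L x y)" if uv: "u \<in> cl x" "v \<in> cl y" for u v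
  proof -
    obtain z w where zw: "z \<in> I" "w \<in> I" "u = lie_add L x z" "v = lie_add L y w"
      using uv by (auto simp: mem_coset)
    let ?r = "lie_add L (lie_bracket L x w) (lie_add L (lie_bracket L z y) (lie_bracket L z w))"
    have "?r \<in> I" using x y zw by (simp add: ideal_add ideal_bracket ideal_bracket' ideal_sub)
    moreover have "lie_bracket L u v = lie_add L (lie_bracket L x y) ?r"
      using x y zw by (simp add: bracket_add_left bracket_add_right add_closed ideal_sub
          bracket_closed add_assoc add_left_commute)
    ultimately show ?thesis using x y by (simp add: coset_add_ideal bracket_closed)
  qed
  then show ?thesis
    unfolding lie_quotient_def lie_structure.simps
    by (intro UN_eq_if_constant[OF self_mem_coset[OF x]] UN_eq_if_constant[OF self_mem_coset[OF y]])
qed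

lemma lie_algebra_quotient: "lie_algebra Q"
proof
  fix X assume "X \<in> lie_carrier Q"
  then obtain x where x: "x \<in> lie_carrier L" "X = cl x" by (auto simp: quot_carrier)
  have "cl (lie_scale L (-1) x) \<in> lie_carrier Q"
    using x by (auto simp: quot_carrier scale_closed)
  moreover have "lie_add Q X (cl (lie_scale L (-1) x)) = lie_zero Q"
    using x by (simp add: quot_add scale_closed add_minus quot_zero)
  ultimately show "\<exists>Y\<in>lie_carrier Q. lie_add Q X Y = lie_zero Q" by blast
next
  fix X Y assume "X \<in> lie_carrier Q" "Y \<in> lie_carrier Q"
  then show "lie_add Q X Y = lie_add Q Y X"
    by (auto simp: quot_carrier quot_add add_commute)
qed (auto simp: quot_carrier quot_zero quot_add quot_scale quot_bracket zero_closed add_closed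
    scale_closed bracket_closed add_assoc add_zero scale_add_right scale_add_left scale_scale
    scale_one bracket_add_left bracket_add_right bracket_scale_left bracket_scale_right
    bracket_self jacobi)

lemma ideal_preimage:
  assumes "lie_ideal Q T"
  shows "lie_ideal L {x \<in> lie_carrier L. cl x \<in> T}"
proof -
  have T: "lie_zero Q \<in> T" "\<And>X Y. X \<in> T \<Longrightarrow> Y \<in> T \<Longrightarrow> lie_add Q X Y \<in> T"
    "\<And>a X. X \<in> T \<Longrightarrow> lie_scale Q a X \<in> T"
    "\<And>X Y. X \<in> lie_carrier Q \<Longrightarrow> Y \<in> T \<Longrightarrow> lie_bracket Q X Y \<in> T"
    using assms by (auto simp: lie_ideal_def lie_subspace_def)
  have "cl (lie_add L x y) \<in> T" if "x \<in> lie_carrier L" "y \<in> lie_carrier L" "cl x \<in> T" "cl y \<in> T"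
    for x y using T(2)[of "cl x" "cl y"] that by (simp add: quot_add)
  moreover have "cl (lie_scale L a x) \<in> T" if "x \<in> lie_carrier L" "cl x \<in> T"
    for a x using T(3)[of "cl x" a] that by (simp add: quot_scale)
  moreover have "cl (lie_bracket L x y) \<in> T"
    if "x \<in> lie_carrier L" "y \<in> lie_carrier L" "cl y \<in> T"
    for x y using T(4)[of "cl x" "cl y"] that by (simp add: quot_bracket quot_carrier)
  ultimately show ?thesis
    using T(1) by (auto simp: lie_ideal_def lie_subspace_def quot_zero zero_closed add_closed
        scale_closed bracket_closed)
qed

text \<open>
  By the correspondence between ideals of the quotient and ideals above \<open>I\<close>, simplicity of the
  quotient says that \<open>I\<close> is a maximal ideal and does not contain the derived algebra.  The premise
  \<open>max\<close> asks more, namely that every ideal outside \<open>I\<close> is the whole algebra, including those that do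
  not contain \<open>I\<close>; in this form it spares working with sums of ideals.
\<close>

lemma simple_quotient:
  assumes nonab: "\<exists>x\<in>lie_carrier L. \<exists>y\<in>lie_carrier L. lie_bracket L x y \<notin> I"
    and max: "\<And>J. lie_ideal L J \<Longrightarrow> \<not> J \<subseteq> I \<Longrightarrow> J = lie_carrier L"
  shows "simple_lie_algebra Q"
proof -
  have "\<exists>X\<in>lie_carrier Q. \<exists>Y\<in>lie_carrier Q. lie_bracket Q X Y \<noteq> lie_zero Q"
  proof -
    obtain x y where xy: "x \<in> lie_carrier L" "y \<in> lie_carrier L" "lie_bracket L x y \<notin> I"
      using nonab by blast
    then have "lie_bracket Q (cl x) (cl y) \<noteq> lie_zero Q"
      by (simp add: quot_bracket quot_zero coset_eq_zero_iff bracket_closed)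
    then show ?thesis using xy by (auto simp: quot_carrier)
  qed
  moreover have "T = {lie_zero Q} \<or> T = lie_carrier Q" if T: "lie_ideal Q T" for T
  proof -
    let ?J = "{x \<in> lie_carrier L. cl x \<in> T}"
    have sub: "T \<subseteq> lie_carrier Q" "lie_zero Q \<in> T"
      using T by (auto simp: lie_ideal_def lie_subspace_def)
    have T_eq: "T = cl ` ?J" using sub by (auto simp: quot_carrier)
    show ?thesis
    proof (cases "?J \<subseteq> I")
      case True
      then have "cl x = lie_zero Q" if "x \<in> ?J" for x
        using that coset_eq_zero_iff by (auto simp: quot_zero)
      then have "cl ` ?J \<subseteq> {lie_zero Q}" by blast
      then have "T \<subseteq> {lie_zero Q}" by (simp flip: T_eq)
      then show ?thesis using sub(2) by blast
    next
      case False
      then have "?J = lie_carrier L" by (rule max[OF ideal_preimage[OF T]])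
      then have "cl ` ?J = lie_carrier Q" by (simp add: quot_carrier)
      then show ?thesis by (simp flip: T_eq)
    qed
  qed
  ultimately show ?thesis
    unfolding simple_lie_algebra_def using lie_algebra_quotient by blast
qed

end


section \<open>The ring of column-finite matrices\<close>

text \<open>
  Giving the column-finite matrices a type of their own makes them an instance of \<^class>\<open>ring_1\<close>,
  so that identities between commutators are proved by ring normalisation.
\<close>

typedef (overloaded) ('k::field) colfin = "lie_carrier (gl_cf :: ('k, 'k inf_mat) lie_structure)"
  morphisms entry Colfin
proof
  show "lie_zero gl_cf \<in> lie_carrier (gl_cf :: ('k, 'k inf_mat) lie_structure)"
    by (simp add: gl_cf_def)
qed

setup_lifting type_definition_colfin

lemma carrier_gl_cf: "A \<in> lie_carrier gl_cf \<longleftrightarrow> (\<forall>j. finite {i. A i j \<noteq> 0})"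
  by (simp add: gl_cf_def)

lemma finite_column: "finite {i. entry x i j \<noteq> 0}"
  using entry[of x] by (simp add: carrier_gl_cf)

lemma colfin_eqI: "(\<And>i j. entry x i j = entry y i j) \<Longrightarrow> x = y"
  by (simp add: entry_inject[symmetric] fun_eq_iff)

lemma finite_column_mat_mult:
  assumes "\<And>k. finite {i. A i k \<noteq> 0}" "finite {k. B k j \<noteq> 0}"
  shows "finite {i. mat_mult A B i j \<noteq> 0}"
proof (rule finite_subset)
  show "{i. mat_mult A B i j \<noteq> 0} \<subseteq> (\<Union>k\<in>{k. B k j \<noteq> 0}. {i. A i k \<noteq> 0})"
  proof
    fix i assume "i \<in> {i. mat_mult A B i j \<noteq> 0}"
    then have "(\<Sum>k | B k j \<noteq> 0. A i k * B k j) \<noteq> 0" by (simp add: mat_mult_def)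
    then obtain k where "B k j \<noteq> 0" "A i k * B k j \<noteq> 0" by (auto elim: sum.not_neutral_contains_not_neutral)
    then show "i \<in> (\<Union>k\<in>{k. B k j \<noteq> 0}. {i. A i k \<noteq> 0})" by auto
  qed
qed (use assms in auto)

instantiation colfin :: (field) ring_1
begin

lift_definition zero_colfin :: "'a colfin" is "\<lambda>i j. 0"
  by (simp add: carrier_gl_cf)

lift_definition one_colfin :: "'a colfin" is "\<lambda>i j. if i = j then 1 else 0"
  by (simp add: carrier_gl_cf)

lift_definition plus_colfin :: "'a colfin \<Rightarrow> 'a colfin \<Rightarrow> 'a colfin" is "\<lambda>A B i j. A i j + B i j"
  unfolding carrier_gl_cf
proof
  fix A B :: "'a inf_mat" and j
  assume "\<forall>j. finite {i. A i j \<noteq> 0}" "\<forall>j. finite {i. B i j \<noteq> 0}"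
  then have "finite ({i. A i j \<noteq> 0} \<union> {i. B i j \<noteq> 0})" by blast
  then show "finite {i. A i j + B i j \<noteq> 0}" by (rule rev_finite_subset) auto
qed

lift_definition uminus_colfin :: "'a colfin \<Rightarrow> 'a colfin" is "\<lambda>A i j. - A i j"
  by (simp add: carrier_gl_cf)

definition minus_colfin :: "'a colfin \<Rightarrow> 'a colfin \<Rightarrow> 'a colfin" where
  "minus_colfin x y = x + - y"

lift_definition times_colfin :: "'a colfin \<Rightarrow> 'a colfin \<Rightarrow> 'a colfin" is mat_mult
  by (simp add: carrier_gl_cf finite_column_mat_mult)

lemma entry_times_sum:
  assumes "finite S" "{k. entry y k j \<noteq> 0} \<subseteq> S"
  shows "entry (x * y) i j = (\<Sum>k\<in>S. entry x i k * entry y k j)"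
  using assms by (simp add: times_colfin.rep_eq mat_mult_eq_sum)

instance
proof
  fix x y z :: "'a colfin"
  show "x + y + z = x + (y + z)" "x + y = y + x" "0 + x = x" "- x + x = 0" "x - y = x + - y"
    by (rule colfin_eqI; simp add: minus_colfin_def plus_colfin.rep_eq uminus_colfin.rep_eq
        zero_colfin.rep_eq add_ac)+
  show "(0::'a colfin) \<noteq> 1"
  proof
    assume "(0::'a colfin) = 1"
    then have "entry (0::'a colfin) 0 0 = entry 1 0 0" by simp
    then show False by (simp add: zero_colfin.rep_eq one_colfin.rep_eq)
  qed
  show "1 * x = x"
  proof (rule colfin_eqI)
    fix i j
    let ?S = "insert i {k. entry x k j \<noteq> 0}"
    have "entry (1 * x) i j = (\<Sum>k\<in>?S. entry 1 i k * entry x k j)"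
      using finite_column by (intro entry_times_sum) auto
    also have "\<dots> = (\<Sum>k\<in>?S. if k = i then entry x k j else 0)"
      by (rule sum.cong) (auto simp: one_colfin.rep_eq)
    also have "\<dots> = entry x i j" using finite_column by (subst sum.delta) auto
    finally show "entry (1 * x) i j = entry x i j" .
  qed
  show "x * 1 = x"
  proof (rule colfin_eqI)
    fix i j
    have "entry (x * 1) i j = (\<Sum>k\<in>{j}. entry x i k * entry 1 k j)"
      by (intro entry_times_sum) (auto simp: one_colfin.rep_eq)
    then show "entry (x * 1) i j = entry x i j" by (simp add: one_colfin.rep_eq)
  qed
  show "(x + y) * z = x * z + y * z"
  proof (rule colfin_eqI)
    fix i j
    have eq: "entry (w * z) i j = (\<Sum>k | entry z k j \<noteq> 0. entry w i k * entry z k j)" for w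
      by (rule entry_times_sum) (auto simp: finite_column)
    show "entry ((x + y) * z) i j = entry (x * z + y * z) i j"
      by (simp add: eq plus_colfin.rep_eq algebra_simps sum.distrib)
  qed
  show "x * (y + z) = x * y + x * z"
  proof (rule colfin_eqI)
    fix i j
    let ?S = "{k. entry y k j \<noteq> 0} \<union> {k. entry z k j \<noteq> 0}"
    have eq: "entry (x * w) i j = (\<Sum>k\<in>?S. entry x i k * entry w k j)"
      if "{k. entry w k j \<noteq> 0} \<subseteq> ?S" for w
      using that by (intro entry_times_sum) (auto simp: finite_column)
    have "entry (x * (y + z)) i j = (\<Sum>k\<in>?S. entry x i k * entry (y + z) k j)"
      by (rule eq) (auto simp: plus_colfin.rep_eq)
    then show "entry (x * (y + z)) i j = entry (x * y + x * z) i j"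
      by (simp add: eq plus_colfin.rep_eq algebra_simps sum.distrib)
  qed
  show "x * y * z = x * (y * z)"
  proof (rule colfin_eqI)
    fix i j
    let ?Z = "{l. entry z l j \<noteq> 0}"
    let ?Y = "(\<Union>l\<in>?Z. {k. entry y k l \<noteq> 0}) \<union> {k. entry (y * z) k j \<noteq> 0}"
    have Y: "finite ?Y" and Z: "finite ?Z" by (auto simp: finite_column)
    have yz: "entry (w * z) i j = (\<Sum>l\<in>?Z. entry w i l * entry z l j)" for w i
      by (rule entry_times_sum) (auto simp: finite_column)
    have "entry (x * y * z) i j = (\<Sum>l\<in>?Z. entry (x * y) i l * entry z l j)" by (rule yz)
    also have "\<dots> = (\<Sum>l\<in>?Z. (\<Sum>k\<in>?Y. entry x i k * entry y k l) * entry z l j)"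
      by (intro sum.cong refl arg_cong2[where f = times] entry_times_sum Y) auto
    also have "\<dots> = (\<Sum>k\<in>?Y. entry x i k * (\<Sum>l\<in>?Z. entry y k l * entry z l j))"
      unfolding sum_distrib_left sum_distrib_right by (subst sum.swap) (simp add: mult.assoc)
    also have "\<dots> = (\<Sum>k\<in>?Y. entry x i k * entry (y * z) k j)" by (simp only: yz)
    also have "\<dots> = entry (x * (y * z)) i j"
      by (rule entry_times_sum[symmetric, OF Y]) auto
    finally show "entry (x * y * z) i j = entry (x * (y * z)) i j" .
  qed
qed

end

lemma entry_minus: "entry (x - y) i j = entry x i j - entry y i j"
  unfolding minus_colfin_def plus_colfin.rep_eq uminus_colfin.rep_eq by simp

lemmas entry_simps = zero_colfin.rep_eq one_colfin.rep_eq plus_colfin.rep_eq uminus_colfin.rep_eq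
  entry_minus

text \<open>
  Scalar multiplication is multiplication by a central element; the module axioms and the
  bilinearity of the bracket then become ring identities too.
\<close>

lift_definition scalar_mat :: "'k::field \<Rightarrow> 'k colfin" is "\<lambda>a i j. if i = j then a else 0"
  by (simp add: carrier_gl_cf)

lemma scalar_mat_times: "entry (scalar_mat a * x) i j = a * entry x i j"
proof -
  let ?S = "insert i {k. entry x k j \<noteq> 0}"
  have "entry (scalar_mat a * x) i j = (\<Sum>k\<in>?S. entry (scalar_mat a) i k * entry x k j)"
    using finite_column by (intro entry_times_sum) auto
  also have "\<dots> = (\<Sum>k\<in>?S. if k = i then a * entry x k j else 0)"
    by (rule sum.cong) (auto simp: scalar_mat.rep_eq)
  also have "\<dots> = a * entry x i j" using finite_column by (subst sum.delta) auto
  finally show ?thesis .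
qed

lemma times_scalar_mat: "entry (x * scalar_mat a) i j = entry x i j * a"
proof -
  have "entry (x * scalar_mat a) i j = (\<Sum>k\<in>{j}. entry x i k * entry (scalar_mat a) k j)"
    by (intro entry_times_sum) (auto simp: scalar_mat.rep_eq)
  then show ?thesis by (simp add: scalar_mat.rep_eq)
qed

lemma scalar_mat_central: "x * scalar_mat a = scalar_mat a * x"
  by (rule colfin_eqI) (simp add: scalar_mat_times times_scalar_mat)

lemma scalar_mat_left_commute: "x * (scalar_mat a * y) = scalar_mat a * (x * y)"
  by (simp add: scalar_mat_central[of x] flip: mult.assoc)

lemma scalar_mat_hom:
  "scalar_mat (a + b) = scalar_mat a + scalar_mat b"
  "scalar_mat (a * b) = scalar_mat a * scalar_mat b"
  "scalar_mat 1 = 1"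
  by (rule colfin_eqI; simp add: scalar_mat_times entry_simps scalar_mat.rep_eq)+

lemma gl_cf_ops:
  "lie_carrier gl_cf = range entry"
  "lie_zero gl_cf = entry 0"
  "lie_add gl_cf (entry x) (entry y) = entry (x + y)"
  "lie_scale gl_cf a (entry x) = entry (scalar_mat a * x)"
  "lie_bracket gl_cf (entry x) (entry y) = entry (x * y - y * x)"
proof -
  show "lie_carrier gl_cf = range entry"
    by (rule type_definition.Rep_range[OF type_definition_colfin, symmetric])

  show "lie_scale gl_cf a (entry x) = entry (scalar_mat a * x)"
    by (intro ext) (simp add: scalar_mat_times gl_cf_def)
qed (simp_all add: gl_cf_def fun_eq_iff entry_simps times_colfin.rep_eq)

lemma lie_algebra_gl_cf: "lie_algebra (gl_cf :: ('k::field, 'k inf_mat) lie_structure)"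
proof
  fix x assume "x \<in> lie_carrier (gl_cf :: ('k, 'k inf_mat) lie_structure)"
  then obtain a where "x = entry a" by (auto simp: gl_cf_ops)
  then have "lie_add gl_cf x (entry (- a)) = lie_zero gl_cf" by (simp add: gl_cf_ops)
  then show "\<exists>y\<in>lie_carrier gl_cf. lie_add gl_cf x y = lie_zero gl_cf" by (auto simp: gl_cf_ops)
next
  fix x y and a b :: 'k
  assume "x \<in> lie_carrier (gl_cf :: ('k, 'k inf_mat) lie_structure)"
    and "y \<in> lie_carrier (gl_cf :: ('k, 'k inf_mat) lie_structure)"
  then obtain u v where "x = entry u" "y = entry v" by (auto simp: gl_cf_ops)
  then show "lie_bracket gl_cf (lie_scale gl_cf a x) y = lie_scale gl_cf a (lie_bracket gl_cf x y)"
    and "lie_bracket gl_cf x (lie_scale gl_cf a y) = lie_scale gl_cf a (lie_bracket gl_cf x y)"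
    by (simp_all add: gl_cf_ops right_diff_distrib mult.assoc scalar_mat_left_commute[of u]
        scalar_mat_left_commute[of v])
qed (auto simp: gl_cf_ops algebra_simps scalar_mat_hom)


section \<open>Row and column selections\<close>

text \<open>
  For an injective \<open>f\<close>, multiplying by \<open>cols_mat f\<close> on the right selects the columns \<open>f 0, f 1, \<dots>\<close>, and
  multiplying by \<open>rows_mat f\<close> on the left selects the rows.  As endomorphisms they are the
  embedding of the space onto the span of the basis vectors indexed by \<open>range f\<close>, and the matching
  projection.  The matrix of \<open>rows_mat f\<close> has a column with infinitely many entries when \<open>f\<close> has an
  infinite fibre, so it is set to \<open>0\<close> unless \<open>f\<close> is injective.
\<close>

lift_definition cols_mat :: "(nat \<Rightarrow> nat) \<Rightarrow> 'k::field colfin" is "\<lambda>f i n. if i = f n then 1 else 0"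
  by (simp add: carrier_gl_cf)

lift_definition rows_mat :: "(nat \<Rightarrow> nat) \<Rightarrow> 'k::field colfin" is
  "\<lambda>f n i. if inj f \<and> i = f n then 1 else 0"
proof -
  fix f :: "nat \<Rightarrow> nat"
  have "finite {n. inj f \<and> j = f n}" for j
  proof (cases "inj f")
    case True
    then have "finite (f -` {j})" by (intro finite_vimageI) auto
    then show ?thesis using True by (auto simp: vimage_def eq_commute)
  qed simp
  then show "(\<lambda>n i. if inj f \<and> i = f n then 1 else 0) \<in> lie_carrier gl_cf"
    by (simp add: carrier_gl_cf)
qed

lemma entry_times_cols: "entry (x * cols_mat f) i n = entry x i (f n)"
proof -
  have "entry (x * cols_mat f) i n = (\<Sum>k\<in>{f n}. entry x i k * entry (cols_mat f) k n)"
    by (intro entry_times_sum) (auto simp: cols_mat.rep_eq)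
  then show ?thesis by (simp add: cols_mat.rep_eq)
qed

lemma entry_rows_times:
  assumes "inj f" shows "entry (rows_mat f * x) n j = entry x (f n) j"
proof -
  let ?S = "insert (f n) {k. entry x k j \<noteq> 0}"
  have "entry (rows_mat f * x) n j = (\<Sum>k\<in>?S. entry (rows_mat f) n k * entry x k j)"
    using finite_column by (intro entry_times_sum) auto
  also have "\<dots> = (\<Sum>k\<in>?S. if k = f n then entry x k j else 0)"
    using assms by (intro sum.cong) (auto simp: rows_mat.rep_eq)
  also have "\<dots> = entry x (f n) j" using finite_column by (subst sum.delta) auto
  finally show ?thesis .
qed

lemma entry_times_rows:
  assumes f: "inj f"
  shows "entry (x * rows_mat f) i (f n) = entry x i n"
    and "j \<notin> range f \<Longrightarrow> entry (x * rows_mat f) i j = 0"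
proof -
  have "entry (x * rows_mat f) i (f n) = (\<Sum>k\<in>{n}. entry x i k * entry (rows_mat f) k (f n))"
    by (intro entry_times_sum) (auto simp: rows_mat.rep_eq inj_eq[OF f])
  then show "entry (x * rows_mat f) i (f n) = entry x i n" by (simp add: rows_mat.rep_eq f)
next
  assume "j \<notin> range f"
  then have "entry (x * rows_mat f) i j = (\<Sum>k\<in>{}. entry x i k * entry (rows_mat f) k j)"
    by (intro entry_times_sum) (auto simp: rows_mat.rep_eq)
  then show "entry (x * rows_mat f) i j = 0" by simp
qed

lemma rows_times_cols:
  assumes "inj f"
  shows "rows_mat f * cols_mat f = 1"
    and "range f \<inter> range g = {} \<Longrightarrow> rows_mat f * cols_mat g = 0"
proof -
  show "rows_mat f * cols_mat f = 1"
    by (rule colfin_eqI) (auto simp: entry_rows_times cols_mat.rep_eq entry_simps inj_eq assms)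
next
  assume "range f \<inter> range g = {}"
  then have "f i \<noteq> g j" for i j by blast
  then show "rows_mat f * cols_mat g = 0"
    by (intro colfin_eqI) (simp add: entry_rows_times cols_mat.rep_eq entry_simps assms)
qed

lemma cols_times_rows:
  assumes "inj f"
  shows "entry (cols_mat f * rows_mat f :: 'k::field colfin) i j = (if i = j \<and> j \<in> range f then 1 else 0)"
  using entry_times_rows[OF assms, where x = "cols_mat f :: 'k colfin"]
  by (cases "j \<in> range f") (auto simp: cols_mat.rep_eq)


section \<open>Every column-finite matrix is a commutator\<close>

abbreviation shift_mat :: "'k::field colfin" where "shift_mat \<equiv> rows_mat Suc"

lemma entry_shift_times: "entry (shift_mat * x) i j = entry x (Suc i) j"
  by (simp add: entry_rows_times)

lemma entry_times_shift: "entry (x * shift_mat) i j = (case j of 0 \<Rightarrow> 0 | Suc m \<Rightarrow> entry x i m)"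
  using entry_times_rows[where f = Suc and x = x and i = i] by (cases j) auto

text \<open>
  The solution \<open>z\<close> of \<open>d z - e z d = M\<close>, where \<open>d\<close> is the shift.  Since \<open>d\<close> moves rows up and
  columns to the right, entry \<open>(i, j)\<close> of the equation reads
  \<open>z (i + 1) j - e * z i (j - 1) = M i j\<close>, with the second term absent for \<open>j = 0\<close>; it determines row
  \<open>i + 1\<close> from row \<open>i\<close>, and row \<open>0\<close> is free.
\<close>

fun twisted_solution :: "'k::field \<Rightarrow> 'k inf_mat \<Rightarrow> 'k inf_mat" where
  "twisted_solution e M 0 j = 0"
| "twisted_solution e M (Suc i) 0 = M i 0"
| "twisted_solution e M (Suc i) (Suc j) = M i (Suc j) + e * twisted_solution e M i j"

text \<open>
  Induction on the column: away from row \<open>0\<close>, a nonzero entry in column \<open>j + 1\<close> comes from the row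
  above, either from column \<open>j + 1\<close> of \<open>M\<close> or from column \<open>j\<close> of the solution.
\<close>

lemma finite_column_twisted_solution:
  assumes M: "\<And>j. finite {i. M i j \<noteq> 0}"
  shows "finite {i. twisted_solution e M i j \<noteq> 0}"
proof (induction j)
  case 0
  have "{i. twisted_solution e M i 0 \<noteq> 0} \<subseteq> Suc ` {i. M i 0 \<noteq> 0}"
  proof
    fix i assume "i \<in> {i. twisted_solution e M i 0 \<noteq> 0}"
    then show "i \<in> Suc ` {i. M i 0 \<noteq> 0}" by (cases i) auto
  qed
  then show ?case by (rule finite_subset) (simp add: M)
next
  case (Suc j)
  have "{i. twisted_solution e M i (Suc j) \<noteq> 0}
    \<subseteq> Suc ` ({i. M i (Suc j) \<noteq> 0} \<union> {i. twisted_solution e M i j \<noteq> 0})"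
  proof
    fix i assume "i \<in> {i. twisted_solution e M i (Suc j) \<noteq> 0}"
    then show "i \<in> Suc ` ({i. M i (Suc j) \<noteq> 0} \<union> {i. twisted_solution e M i j \<noteq> 0})"
      by (cases i) auto
  qed
  then show ?case by (rule finite_subset) (simp add: M Suc.IH)
qed

lemma twisted_commutator_surj: "\<exists>z. shift_mat * z - scalar_mat e * (z * shift_mat) = x"
proof -
  define z where "z = Colfin (twisted_solution e (entry x))"
  have z: "entry z = twisted_solution e (entry x)"
    unfolding z_def
    by (rule Colfin_inverse) (simp add: carrier_gl_cf finite_column_twisted_solution finite_column)
  have "entry (shift_mat * z - scalar_mat e * (z * shift_mat)) i j = entry x i j" for i j
    by (cases j) (simp_all add: entry_minus scalar_mat_times entry_shift_times entry_times_shift z)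
  then show ?thesis by (intro exI[of _ z] colfin_eqI)
qed

text \<open>
  The twist \<open>e = 1\<close> gives commutators and \<open>e = -1\<close> gives anticommutators.  The latter are needed
  because \<open>x = (x / 2) 1 + 1 (x / 2)\<close> is not available in characteristic 2.
\<close>

lemma commutator_surj: "\<exists>y z. y * z - z * y = (x :: 'k::field colfin)"
  using twisted_commutator_surj[of 1 x] by (auto simp: scalar_mat_hom)

lemma scalar_mat_minus_one: "scalar_mat (-1) = -1"
  by (rule colfin_eqI) (simp add: scalar_mat.rep_eq entry_simps)

lemma anticommutator_surj: "\<exists>y z. y * z + z * y = (x :: 'k::field colfin)"
  using twisted_commutator_surj[of "-1" x] by (auto simp: scalar_mat_minus_one)


section \<open>Lie ideals of a ring with a three-block decomposition\<close>

locale additive_lie_ideal =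
  fixes J :: "'a::ring_1 set"
  assumes add: "x \<in> J \<Longrightarrow> y \<in> J \<Longrightarrow> x + y \<in> J"
    and bracket: "y \<in> J \<Longrightarrow> x * y - y * x \<in> J"
begin

lemma bracket_right: "y \<in> J \<Longrightarrow> y * x - x * y \<in> J"
  using bracket[of y "-x"] by simp

text \<open>
  Since \<open>t s = 0\<close> and \<open>t a s = 1\<close>, of the four terms of the double commutator
  \<open>[[a, s y t], s z t]\<close> the two that contain \<open>t s\<close> vanish and the other two add up to
  \<open>- s (y z + z y) t\<close>.
\<close>

lemma corner_mem:
  assumes a: "a \<in> J" and ts: "t * s = 0" and tas: "t * a * s = 1"
    and anti: "\<And>x :: 'a. \<exists>y z. y * z + z * y = x"
  shows "s * x * t \<in> J"
proof -
  obtain y z where yz: "y * z + z * y = - x" using anti by blast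
  let ?u = "s * y * t" and ?v = "s * z * t"
  have ts': "t * (s * w) = 0" for w using ts by (simp flip: mult.assoc)
  have tas': "t * (a * (s * w)) = w" for w using tas by (simp flip: mult.assoc)
  have "(a * ?u - ?u * a) * ?v - ?v * (a * ?u - ?u * a) = - (s * (y * z + z * y) * t)"
    by (simp add: algebra_simps ts' tas')
  moreover have "(a * ?u - ?u * a) * ?v - ?v * (a * ?u - ?u * a) \<in> J"
    by (intro bracket_right a)
  ultimately show ?thesis using yz by simp
qed

text \<open>
  The elements \<open>s k\<close> and \<open>t k\<close> identify the ring with the 3 by 3 matrices over itself, with
  \<open>s k * x * t l\<close> the matrix having \<open>x\<close> in position \<open>(k, l)\<close>.  Commutators with matrix units change one
  index of an off-diagonal block to the third index, which reaches all six off-diagonal blocks.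
  Commutators of opposite blocks give \<open>y z\<close> in position \<open>(i, i)\<close> minus \<open>z y\<close> in position \<open>(j, j)\<close>; going once
  around the three indices turns this into \<open>y z - z y\<close> in position \<open>(i, i)\<close>.
\<close>

lemma eq_UNIV_if_block:
  fixes s t :: "nat \<Rightarrow> 'a"
  assumes ts: "\<And>k l. k < 3 \<Longrightarrow> l < 3 \<Longrightarrow> t k * s l = (if k = l then 1 else 0)"
    and one: "(\<Sum>k<3. s k * t k) = 1"
    and comm: "\<And>x :: 'a. \<exists>y z. y * z - z * y = x"
    and block: "\<And>x. s 1 * x * t 2 \<in> J"
  shows "J = UNIV"
proof -
  have ts': "t k * (s l * w) = (if k = l then w else 0)" if "k < 3" "l < 3" for k l w
    using ts[OF that] by (simp flip: mult.assoc)
  have row: "s k * x * t j \<in> J"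
    if "\<And>x. s i * x * t j \<in> J" "i < 3" "j < 3" "k < 3" "k \<noteq> j" "i \<noteq> j" for i j k x
    using bracket[OF that(1), of "s k * t i" x] that by (simp add: mult.assoc ts')
  have col: "s i * x * t k \<in> J"
    if "\<And>x. s i * x * t j \<in> J" "i < 3" "j < 3" "k < 3" "k \<noteq> i" "i \<noteq> j" for i j k x
    using bracket_right[OF that(1), of x "s j * t k"] that by (simp add: mult.assoc ts')
  have s02: "s 0 * x * t 2 \<in> J" for x using row[OF block] by simp
  have s10: "s 1 * x * t 0 \<in> J" for x using col[OF block] by simp
  have s01: "s 0 * x * t 1 \<in> J" for x using col[OF s02] by simp
  have s20: "s 2 * x * t 0 \<in> J" for x using row[OF s10] by simp
  have s21: "s 2 * x * t 1 \<in> J" for x using row[OF s01] by simp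
  have off: "s i * x * t j \<in> J" if "i < 3" "j < 3" "i \<noteq> j" for i j x
    using that block s02 s10 s01 s20 s21 by (auto simp: numeral_3_eq_3 less_Suc_eq numeral_2_eq_2)
  have diff: "s i * (y * z) * t i - s j * (z * y) * t j \<in> J"
    if "i < 3" "j < 3" "i \<noteq> j" for i j y z
    using bracket[OF off[of j i z], of "s i * y * t j"] that by (simp add: mult.assoc ts')
  have diag: "s i * x * t i \<in> J" if i: "i < 3" for i x
  proof -
    obtain j k where jk: "j < 3" "k < 3" "i \<noteq> j" "i \<noteq> k" "j \<noteq> k"
    proof -
      consider "i = 0" | "i = 1" | "i = 2" using i by linarith
      then show thesis using that[of 1 2] that[of 0 2] that[of 0 1] by cases auto
    qed
    obtain y z where yz: "y * z - z * y = x" using comm by blast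
    have "s i * (y * z - z * y) * t i
      = (s i * (y * z) * t i - s j * (z * y) * t j) + ((s j * (z * y) * t j - s k * (y * z) * t k)
        + (s k * (y * z) * t k - s i * (z * y) * t i))"
      by (simp add: algebra_simps)
    also have "\<dots> \<in> J"
      using i jk by (intro add diff) auto
    finally show ?thesis using yz by simp
  qed
  have mem: "s i * x * t j \<in> J" if "i < 3" "j < 3" for i j x
    using off diag that by (cases "i = j") auto
  have sum_mem: "(\<Sum>k<3. f k) \<in> J" if "\<And>k. k < 3 \<Longrightarrow> f k \<in> J" for f :: "nat \<Rightarrow> 'a"
    using that by (simp add: eval_nat_numeral add)
  have "x \<in> J" for x
  proof -
    have "x = (\<Sum>i<3. s i * t i) * x * (\<Sum>j<3. s j * t j)" using one by simp
    also have "\<dots> = (\<Sum>i<3. \<Sum>j<3. s i * (t i * x * s j) * t j)"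
      by (simp add: sum_distrib_left sum_distrib_right mult.assoc, rule sum.swap)
    also have "\<dots> \<in> J" by (intro sum_mem mem) auto
    finally show ?thesis .
  qed
  then show ?thesis by blast
qed

end


section \<open>The quotient by scalar plus finite-row matrices\<close>

text \<open>
  Solving \<open>W U = 1\<close> along row \<open>n\<close> from left to right: for an upper triangular \<open>U\<close> the equation in
  column \<open>m\<close> involves only the entries \<open>W n k\<close> with \<open>k \<le> m\<close>.
\<close>

fun triangular_left_inverse :: "'k::field inf_mat \<Rightarrow> 'k inf_mat" where
  "triangular_left_inverse U n m =
    ((if n = m then 1 else 0) - (\<Sum>k<m. triangular_left_inverse U n k * U k m)) / U m m"

declare triangular_left_inverse.simps [simp del]

lemma left_invertible_if_triangular:
  fixes u :: "'k::field colfin"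
  assumes upper: "\<And>n m. m < n \<Longrightarrow> entry u n m = 0"
    and diag: "\<And>n. entry u n n \<noteq> 0"
  shows "\<exists>w. w * u = 1"
proof -
  let ?W = "triangular_left_inverse (entry u)"
  have W_upper: "?W n m = 0" if "m < n" for n m
    using that
  proof (induction m rule: less_induct)
    case (less m)
    then have "(\<Sum>k<m. ?W n k * entry u k m) = 0" by (intro sum.neutral) auto
    then show ?case using less.prems by (subst triangular_left_inverse.simps) simp
  qed
  have "finite {n. ?W n m \<noteq> 0}" for m
    by (rule finite_subset[of _ "{..m}"]) (use W_upper not_less in auto)
  then have "?W \<in> lie_carrier gl_cf" by (simp add: carrier_gl_cf)
  then obtain w where w: "entry w = ?W" by (metis Colfin_inverse)
  have "entry (w * u) n m = entry 1 n m" for n m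
  proof -
    have "entry (w * u) n m = (\<Sum>k\<in>{..m}. entry w n k * entry u k m)"
      using upper by (intro entry_times_sum) (auto simp: not_less[symmetric])
    also have "\<dots> = (\<Sum>k<m. ?W n k * entry u k m) + ?W n m * entry u m m"
      by (simp add: w lessThan_Suc_atMost[symmetric])
    also have "?W n m * entry u m m = (if n = m then 1 else 0) - (\<Sum>k<m. ?W n k * entry u k m)"
      by (subst triangular_left_inverse.simps) (simp add: diag)
    finally show ?thesis by (simp add: one_colfin.rep_eq)
  qed
  then show ?thesis by (intro exI[of _ w] colfin_eqI)
qed

text \<open>
  The pairs \<open>(p n, q n)\<close> are chosen one after the other.  The row \<open>p n\<close> has to avoid all earlier
  indices and the supports of all columns with earlier indices, which is a finite set of rows.
  Avoiding the columns \<open>q m\<close> makes the submatrix upper triangular; avoiding the columns \<open>p m\<close> as well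
  forces the nonzero entry found in row \<open>p n\<close> to lie in a new column.
\<close>

lemma triangular_submatrix:
  fixes a :: "'k::field colfin"
  assumes inf: "infinite {i. \<exists>j. j \<noteq> i \<and> entry a i j \<noteq> 0}"
  obtains p q :: "nat \<Rightarrow> nat" where "inj p" "inj q" "range p \<inter> range q = {}"
    "\<And>n. entry a (p n) (q n) \<noteq> 0" "\<And>m n. m < n \<Longrightarrow> entry a (p n) (q m) = 0"
proof -
  define good where "good s r \<longleftrightarrow> fst r \<notin> {fst s, snd s} \<and> snd r \<notin> {fst s, snd s}
    \<and> entry a (fst r) (snd s) = 0" for s r :: "nat \<times> nat"
  define P where "P f n r \<longleftrightarrow> fst r \<noteq> snd r \<and> entry a (fst r) (snd r) \<noteq> 0 \<and> (\<forall>m<n. good (f m) r)"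
    for f and n :: nat and r
  have "\<exists>f. \<forall>n. P f n (f n)"
  proof (rule dependent_wellorder_choice)
    fix r and f g :: "nat \<Rightarrow> nat \<times> nat" and n :: nat
    assume "\<And>m. m < n \<Longrightarrow> f m = g m"
    then show "P f n r = P g n r" by (simp add: P_def)
  next
    fix n and f :: "nat \<Rightarrow> nat \<times> nat"
    let ?bad = "\<Union>m<n. {fst (f m), snd (f m)} \<union> {i. entry a i (fst (f m)) \<noteq> 0}
      \<union> {i. entry a i (snd (f m)) \<noteq> 0}"
    have "finite ?bad" by (auto simp: finite_column)
    then obtain i where "i \<in> {i. \<exists>j. j \<noteq> i \<and> entry a i j \<noteq> 0}" and i: "i \<notin> ?bad"
      using inf by (meson finite_subset subsetI)
    then obtain j where j: "j \<noteq> i" "entry a i j \<noteq> 0" by blast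
    have "good (f m) (i, j)" if "m < n" for m
      using i j that by (auto simp: good_def)
    then show "\<exists>r. P f n r" using j by (intro exI[of _ "(i, j)"]) (simp add: P_def)
  qed
  then obtain f where f: "P f n (f n)" for n by blast
  have good: "good (f m) (f n)" if "m < n" for m n using f[of n] that by (simp add: P_def)
  have lt: "fst (f m) \<noteq> fst (f n)" "snd (f m) \<noteq> snd (f n)" if "m < n" for m n
    using good[OF that] by (auto simp: good_def)
  have ne: "fst (f n) \<noteq> snd (f n)" for n using f[of n] by (simp add: P_def)
  show thesis
  proof (rule that[of "fst \<circ> f" "snd \<circ> f"])
    show "inj (fst \<circ> f)"
      by (rule linorder_injI) (simp add: lt)
    show "inj (snd \<circ> f)"
      by (rule linorder_injI) (simp add: lt)
    have "fst (f n) \<noteq> snd (f m)" for n m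
      using ne[of n] good[of m n] good[of n m] by (cases m n rule: linorder_cases) (auto simp: good_def)
    then show "range (fst \<circ> f) \<inter> range (snd \<circ> f) = {}" by auto
    show "entry a ((fst \<circ> f) n) ((snd \<circ> f) n) \<noteq> 0" for n using f[of n] by (simp add: P_def)
    show "entry a ((fst \<circ> f) n) ((snd \<circ> f) m) = 0" if "m < n" for m n
      using good[OF that] by (simp add: good_def)
  qed
qed

context
  fixes J :: "'k::field colfin set"
  assumes J: "additive_lie_ideal J"
begin

interpretation additive_lie_ideal J by (rule J)

text \<open>
  With \<open>S\<close> and \<open>P\<close> the selections of the columns \<open>q\<close> and \<open>p\<close>, \<open>T\<close> the selection of the rows \<open>p\<close>, and
  \<open>w\<close> a left inverse of \<open>u = T a S\<close>, the elements \<open>S\<close> and \<open>w T\<close> satisfy the hypotheses of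
  \<open>corner_mem\<close>.  The factor \<open>w\<close> is then removed by a commutator with \<open>P u x T\<close>.
\<close>

lemma ideal_eq_UNIV_if_infinite_off_diagonal:
  assumes a: "a \<in> J" and inf: "infinite {i. \<exists>j. j \<noteq> i \<and> entry a i j \<noteq> 0}"
  shows "J = UNIV"
proof -
  obtain p' q' :: "nat \<Rightarrow> nat" where pq': "inj p'" "inj q'" "range p' \<inter> range q' = {}"
    "\<And>n. entry a (p' n) (q' n) \<noteq> 0" "\<And>m n. m < n \<Longrightarrow> entry a (p' n) (q' m) = 0"
    by (rule triangular_submatrix[OF inf]) (rule that, assumption+)
  have disj': "p' m \<noteq> q' n" for m n by (metis IntI emptyE pq'(3) rangeI)
  \<comment> \<open>Passing to every other pair makes the set of unused indices infinite, so that it can serve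
    as the third block.\<close>
  define p where "p n = p' (2 * n)" for n
  define q where "q n = q' (2 * n)" for n
  have p: "inj p" and q: "inj q" by (auto simp: p_def q_def inj_eq[OF pq'(1)] inj_eq[OF pq'(2)] intro!: injI)
  have disj: "p m \<noteq> q n" for m n by (simp add: p_def q_def disj')
  define R where "R = - (range p \<union> range q)"
  define r where "r = enumerate R"
  have "infinite (range (\<lambda>n. p' (2 * n + 1)))"
    by (rule range_inj_infinite) (simp add: inj_def inj_eq[OF pq'(1)])
  moreover have "range (\<lambda>n. p' (2 * n + 1)) \<subseteq> R"
  proof -
    have "p' (2 * n + 1) \<noteq> p m" for n m
      unfolding p_def inj_eq[OF pq'(1)] by presburger
    moreover have "p' (2 * n + 1) \<noteq> q m" for n m by (simp add: q_def disj')
    ultimately show ?thesis by (auto simp: R_def)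
  qed
  ultimately have "infinite R" using finite_subset by blast
  then have r: "inj r" "range r = R" using bij_enumerate[of R] by (auto simp: r_def bij_betw_def)
  define f where "f k = (if k = 0 then r else if k = 1 then q else p)" for k :: nat
  have f_inj: "inj (f k)" for k using r p q by (simp add: f_def)
  have f_disj: "range (f k) \<inter> range (f l) = {}" if "k < 3" "l < 3" "k \<noteq> l" for k l
  proof -
    have "range p \<inter> range q = {}" using disj by blast
    then show ?thesis using that by (auto simp: f_def r R_def)
  qed
  have f_cover: "(\<Sum>k<3. if j \<in> range (f k) then 1 else 0) = (1 :: 'k)" for j
    using disj disj[symmetric] by (auto simp: eval_nat_numeral f_def r R_def)
  define S where "S = (cols_mat q :: 'k colfin)"
  define P where "P = (cols_mat p :: 'k colfin)"
  define T where "T = (rows_mat p :: 'k colfin)"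
  define u where "u = T * a * S"
  have u: "entry u n m = entry a (p n) (q m)" for n m
    by (simp add: u_def S_def T_def entry_times_cols entry_rows_times p)
  obtain w where w: "w * u = 1"
    using left_invertible_if_triangular[of u] pq' by (auto simp: u p_def q_def)
  have TP: "T * P = 1" and TS: "T * S = 0"
    unfolding T_def P_def S_def using disj p by (auto intro!: rows_times_cols)
  have T': "T * (P * x) = x" "T * (S * x) = 0" for x
    using TP TS by (simp_all flip: mult.assoc)
  have mem: "S * 1 * (w * T) \<in> J"
  proof (rule corner_mem[OF a])
    show "w * T * S = 0" using TS by (simp add: mult.assoc)
    show "w * T * a * S = 1" using w by (simp add: u_def mult.assoc)
  qed (rule anticommutator_surj)
  have block: "S * x * T \<in> J" for x
  proof -
    have "w * (u * y) = y" for y using w by (simp flip: mult.assoc)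
    then have "S * 1 * (w * T) * (P * u * x * T) - P * u * x * T * (S * 1 * (w * T)) = S * x * T"
      by (simp add: mult.assoc T')
    then show ?thesis using bracket_right[OF mem] by metis
  qed
  show ?thesis
  proof (rule eq_UNIV_if_block[of "\<lambda>k. rows_mat (f k)" "\<lambda>k. cols_mat (f k)"])
    show "rows_mat (f k) * cols_mat (f l) = (if k = l then 1 else 0 :: 'k colfin)"
      if "k < 3" "l < 3" for k l
      using that by (cases "k = l") (simp_all add: rows_times_cols f_inj f_disj)
    have "entry (\<Sum>k<3. cols_mat (f k) * rows_mat (f k)) i j = entry (1 :: 'k colfin) i j" for i j
    proof -
      have "entry (\<Sum>k<3. cols_mat (f k) * rows_mat (f k) :: 'k colfin) i j
        = (\<Sum>k<3. if i = j \<and> j \<in> range (f k) then 1 else 0)"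
        by (simp add: eval_nat_numeral entry_simps cols_times_rows f_inj)
      then show ?thesis using f_cover[of j] by (cases "i = j") (auto simp: entry_simps)
    qed
    then show "(\<Sum>k<3. cols_mat (f k) * rows_mat (f k)) = (1 :: 'k colfin)" by (rule colfin_eqI)
    show "cols_mat (f 1) * x * rows_mat (f 2) \<in> J" for x
      using block by (simp add: f_def S_def T_def)
  qed (rule commutator_surj)
qed

text \<open>
  The commutator of \<open>a\<close> with the shift has \<open>a i i - a (i + 1) (i + 1)\<close> in position \<open>(i, i + 1)\<close>.
  If both \<open>a\<close> and this commutator had nonzero off-diagonal entries in finitely many rows only,
  then from some row on \<open>a\<close> would be diagonal with constant diagonal entry.
\<close>

lemma ideal_eq_UNIV_if_not_scalar_plus_finite:
  assumes a: "a \<in> J" and not: "entry a \<notin> lie_sum gl_cf d_sc gl_fr"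
  shows "J = UNIV"
proof (cases "finite {i. \<exists>j. j \<noteq> i \<and> entry a i j \<noteq> 0}")
  case False
  then show ?thesis by (rule ideal_eq_UNIV_if_infinite_off_diagonal[OF a])
next
  case fin: True
  let ?b = "a * shift_mat - shift_mat * a"
  have b: "?b \<in> J" by (rule bracket_right[OF a])
  have b_entry: "entry ?b i (Suc i) = entry a i i - entry a (Suc i) (Suc i)" for i
    by (simp add: entry_minus entry_times_shift entry_shift_times)
  have "infinite {i. \<exists>j. j \<noteq> i \<and> entry ?b i j \<noteq> 0}"
  proof
    assume "finite {i. \<exists>j. j \<noteq> i \<and> entry ?b i j \<noteq> 0}"
    with fin have "finite ({i. \<exists>j. j \<noteq> i \<and> entry a i j \<noteq> 0} \<union> {i. \<exists>j. j \<noteq> i \<and> entry ?b i j \<noteq> 0})"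
      by blast
    then obtain N where N: "\<And>i. i \<in> {i. \<exists>j. j \<noteq> i \<and> entry a i j \<noteq> 0}
        \<union> {i. \<exists>j. j \<noteq> i \<and> entry ?b i j \<noteq> 0} \<Longrightarrow> i < N"
      unfolding finite_nat_set_iff_bounded by blast
    have off: "entry a i j = 0" if "N \<le> i" "j \<noteq> i" for i j
      using N[of i] that by auto
    have step: "entry a (Suc i) (Suc i) = entry a i i" if "N \<le> i" for i
    proof (rule ccontr)
      assume "entry a (Suc i) (Suc i) \<noteq> entry a i i"
      then have "entry ?b i (Suc i) \<noteq> 0" by (simp add: b_entry)
      then have "\<exists>j. j \<noteq> i \<and> entry ?b i j \<noteq> 0" by (metis n_not_Suc_n)
      then show False using N[of i] that by simp
    qed
    have const: "entry a i i = entry a N N" if "N \<le> i" for i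
      using that by (induction i rule: dec_induct) (simp_all add: step)
    define F where "F = a - scalar_mat (entry a N N)"
    have F: "entry F i j = 0" if "N \<le> i" for i j
      using that off[of i j] const[of i] by (auto simp: F_def entry_minus scalar_mat.rep_eq)
    have "finite {i. \<exists>j. entry F i j \<noteq> 0}"
      by (rule finite_subset[of _ "{..<N}"]) (use F in \<open>auto intro: ccontr simp: not_less\<close>)
    then have "entry F \<in> gl_fr" by (simp add: gl_fr_def entry)
    moreover have "entry (scalar_mat (entry a N N)) \<in> d_sc"
      by (auto simp: d_sc_def scalar_mat.rep_eq fun_eq_iff intro!: exI[of _ "entry a N N"])
    moreover have "entry a = lie_add gl_cf (entry (scalar_mat (entry a N N))) (entry F)"
      by (simp add: gl_cf_ops F_def)
    ultimately show False using not by (auto simp: lie_sum_def)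
  qed
  then show ?thesis by (rule ideal_eq_UNIV_if_infinite_off_diagonal[OF b])
qed

end

lemma additive_lie_ideal_gl_cf:
  fixes J :: "'k::field inf_mat set"
  assumes "lie_ideal gl_cf J"
  shows "additive_lie_ideal (entry -` J)"
proof -
  have J: "\<And>x y. x \<in> J \<Longrightarrow> y \<in> J \<Longrightarrow> lie_add gl_cf x y \<in> J"
    "\<And>x y. x \<in> lie_carrier gl_cf \<Longrightarrow> y \<in> J \<Longrightarrow> lie_bracket gl_cf x y \<in> J"
    using assms by (auto simp: lie_ideal_def lie_subspace_def)
  show ?thesis
  proof
    fix x y :: "'k colfin"
    assume y: "y \<in> entry -` J"
    show "x * y - y * x \<in> entry -` J"
      using J(2)[of "entry x" "entry y"] y by (simp add: gl_cf_ops)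
    assume "x \<in> entry -` J"
    then show "x + y \<in> entry -` J"
      using J(1)[of "entry x" "entry y"] y by (simp add: gl_cf_ops)
  qed
qed

lemma simple_quotient_gl_cf:
  "simple_lie_algebra (lie_quotient gl_cf (lie_sum gl_cf d_sc gl_fr :: 'k::field inf_mat set))"
proof -
  let ?I = "lie_sum gl_cf d_sc gl_fr :: 'k inf_mat set"
  interpret lie_algebra_ideal gl_cf ?I
    by (intro lie_algebra_ideal.intro lie_algebra_gl_cf lie_algebra_ideal_axioms.intro
        lie_ideal_d_sc_gl_fr)
  show ?thesis
  proof (rule simple_quotient)
    fix J assume J: "lie_ideal gl_cf J" and "\<not> J \<subseteq> ?I"
    moreover have sub: "J \<subseteq> range entry"
      using J by (simp add: lie_ideal_def lie_subspace_def gl_cf_ops(1))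
    ultimately obtain a where a: "entry a \<in> J" "entry a \<notin> ?I" by blast
    then have "entry -` J = UNIV"
      using ideal_eq_UNIV_if_not_scalar_plus_finite[OF additive_lie_ideal_gl_cf[OF J]] by blast
    then show "J = lie_carrier gl_cf" using sub by (auto simp: gl_cf_ops(1))
  next
    \<comment> \<open>The shift is a commutator, and it has an off-diagonal entry in every row.\<close>
    have "entry shift_mat \<notin> ?I"
    proof
      assume "entry shift_mat \<in> ?I"
      then obtain c and F :: "'k inf_mat" where F: "F \<in> gl_fr"
        and eq: "entry shift_mat = lie_add gl_cf (\<lambda>i j. c * (if i = j then 1 else 0)) F"
        by (auto simp: lie_sum_def d_sc_def)
      have "F i (Suc i) = 1" for i
        using fun_cong[OF fun_cong[OF eq], of i "Suc i"] by (simp add: gl_cf_def rows_mat.rep_eq)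
      then have "\<exists>j. F i j \<noteq> 0" for i by (intro exI[of _ "Suc i"]) simp
      then have "{i. \<exists>j. F i j \<noteq> 0} = UNIV" by blast
      then show False using F by (simp add: gl_fr_def)
    qed
    moreover obtain y z where "y * z - z * y = (shift_mat :: 'k colfin)"
      using commutator_surj by blast
    ultimately have "lie_bracket gl_cf (entry y) (entry z) \<notin> ?I" by (simp add: gl_cf_ops)
    then show "\<exists>x\<in>lie_carrier gl_cf. \<exists>y\<in>lie_carrier gl_cf. lie_bracket gl_cf x y \<notin> ?I"
      by (auto simp: gl_cf_ops(1))
  qed
qed


section \<open>Finite-row matrices of trace zero\<close>

lemma entry_gl_fr_iff:
  "entry x \<in> gl_fr \<longleftrightarrow> (\<exists>S. finite S \<and> (\<forall>i. i \<notin> S \<longrightarrow> (\<forall>j. entry x i j = 0)))"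
proof
  assume "entry x \<in> gl_fr"
  then show "\<exists>S. finite S \<and> (\<forall>i. i \<notin> S \<longrightarrow> (\<forall>j. entry x i j = 0))"
    by (intro exI[of _ "{i. \<exists>j. entry x i j \<noteq> 0}"]) (auto simp: gl_fr_def)
next
  assume "\<exists>S. finite S \<and> (\<forall>i. i \<notin> S \<longrightarrow> (\<forall>j. entry x i j = 0))"
  then obtain S where "finite S" "\<forall>i. i \<notin> S \<longrightarrow> (\<forall>j. entry x i j = 0)" by blast
  then have "finite {i. \<exists>j. entry x i j \<noteq> 0}"
    by (intro finite_subset[of "{i. \<exists>j. entry x i j \<noteq> 0}" S]) auto
  then show "entry x \<in> gl_fr" by (simp add: gl_fr_def entry)
qed

lemma trace_eq_sum:
  assumes "finite S" "\<And>i j. i \<notin> S \<Longrightarrow> entry x i j = 0"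
  shows "trace_fr (entry x) = (\<Sum>i\<in>S. entry x i i)"
  unfolding trace_fr_def by (rule sum.mono_neutral_left) (use assms in auto)

lemma entry_sl_fr_iff:
  "entry x \<in> sl_fr \<longleftrightarrow>
    (\<exists>S. finite S \<and> (\<forall>i. i \<notin> S \<longrightarrow> (\<forall>j. entry x i j = 0)) \<and> (\<Sum>i\<in>S. entry x i i) = 0)"
proof
  assume x: "entry x \<in> sl_fr"
  then obtain S where S: "finite S" "\<forall>i. i \<notin> S \<longrightarrow> (\<forall>j. entry x i j = 0)"
    unfolding sl_fr_def mem_Collect_eq entry_gl_fr_iff by (elim conjE exE)
  have "(\<Sum>i\<in>S. entry x i i) = trace_fr (entry x)" using S by (intro trace_eq_sum[symmetric]) auto
  then show "\<exists>S. finite S \<and> (\<forall>i. i \<notin> S \<longrightarrow> (\<forall>j. entry x i j = 0)) \<and> (\<Sum>i\<in>S. entry x i i) = 0"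
    using S x by (intro exI[of _ S]) (simp add: sl_fr_def)
next
  assume "\<exists>S. finite S \<and> (\<forall>i. i \<notin> S \<longrightarrow> (\<forall>j. entry x i j = 0)) \<and> (\<Sum>i\<in>S. entry x i i) = 0"
  then obtain S where S: "finite S" "\<forall>i. i \<notin> S \<longrightarrow> (\<forall>j. entry x i j = 0)"
    "(\<Sum>i\<in>S. entry x i i) = 0" by (elim conjE exE)
  have "trace_fr (entry x) = (\<Sum>i\<in>S. entry x i i)" using S(1,2) by (intro trace_eq_sum) auto
  moreover have "entry x \<in> gl_fr" unfolding entry_gl_fr_iff using S(1,2) by (intro exI[of _ S] conjI)
  ultimately show "entry x \<in> sl_fr" using S(3) by (simp add: sl_fr_def)
qed

lemma entry_sl_frI:
  assumes "finite S" "\<And>i j. i \<notin> S \<Longrightarrow> entry x i j = 0" "(\<Sum>i\<in>S. entry x i i) = 0"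
  shows "entry x \<in> sl_fr"
  using assms entry_sl_fr_iff by blast

lemma sl_fr_common_support:
  assumes x: "entry x \<in> sl_fr" and y: "entry y \<in> sl_fr"
  obtains S where "finite S" "\<And>i j. i \<notin> S \<Longrightarrow> entry x i j = 0" "\<And>i j. i \<notin> S \<Longrightarrow> entry y i j = 0"
    "(\<Sum>i\<in>S. entry x i i) = 0" "(\<Sum>i\<in>S. entry y i i) = 0"
proof -
  obtain A B where A: "finite A" "\<forall>i. i \<notin> A \<longrightarrow> (\<forall>j. entry x i j = 0)"
    and B: "finite B" "\<forall>i. i \<notin> B \<longrightarrow> (\<forall>j. entry y i j = 0)"
    using x y by (auto simp: entry_sl_fr_iff)
  show thesis
  proof (rule that[of "A \<union> B"])
    have "trace_fr (entry x) = (\<Sum>i\<in>A \<union> B. entry x i i)"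
      "trace_fr (entry y) = (\<Sum>i\<in>A \<union> B. entry y i i)"
      using A B by (auto intro!: trace_eq_sum)
    then show "(\<Sum>i\<in>A \<union> B. entry x i i) = 0" "(\<Sum>i\<in>A \<union> B. entry y i i) = 0"
      using x y by (simp_all add: sl_fr_def)
  qed (use A B in auto)
qed

lemma sl_fr_add:
  assumes "entry x \<in> sl_fr" "entry y \<in> sl_fr"
  shows "entry (x + y) \<in> sl_fr"
  by (rule sl_fr_common_support[OF assms], rule entry_sl_frI) (auto simp: entry_simps sum.distrib)

lemma sl_fr_scalar_mat:
  assumes "entry x \<in> sl_fr"
  shows "entry (scalar_mat c * x) \<in> sl_fr"
  by (rule sl_fr_common_support[OF assms assms], rule entry_sl_frI)
    (auto simp: scalar_mat_times simp flip: sum_distrib_left)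

lemma sl_fr_uminus: "entry x \<in> sl_fr \<Longrightarrow> entry (- x) \<in> sl_fr"
  using sl_fr_scalar_mat[of x "-1"] by (simp add: scalar_mat_minus_one)

text \<open>
  Both products of two finite-row matrices are computed over a common finite support of rows,
  where the traces agree as for finite matrices.
\<close>

lemma sl_fr_commutator:
  assumes x: "entry x \<in> sl_fr" and y: "entry y \<in> sl_fr"
  shows "entry (x * y - y * x) \<in> sl_fr"
proof -
  obtain S where S: "finite S" "\<And>i j. i \<notin> S \<Longrightarrow> entry x i j = 0" "\<And>i j. i \<notin> S \<Longrightarrow> entry y i j = 0"
    by (rule sl_fr_common_support[OF x y]) (rule that, assumption+)
  have xy: "entry (x * y) i j = (\<Sum>k\<in>S. entry x i k * entry y k j)" for i j
    by (rule entry_times_sum) (use S in auto)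
  have yx: "entry (y * x) i j = (\<Sum>k\<in>S. entry y i k * entry x k j)" for i j
    by (rule entry_times_sum) (use S in auto)
  have "(\<Sum>i\<in>S. entry (x * y) i i) = (\<Sum>k\<in>S. \<Sum>i\<in>S. entry x i k * entry y k i)"
    unfolding xy by (rule sum.swap)
  also have "\<dots> = (\<Sum>i\<in>S. entry (y * x) i i)" unfolding yx by (simp add: mult.commute)
  finally show ?thesis
    by (intro entry_sl_frI[OF S(1)]) (simp_all add: entry_minus xy yx S sum_subtractf)
qed

lemma sl_fr_range: "sl_fr \<subseteq> range entry"
  by (auto simp: sl_fr_def gl_fr_def simp flip: gl_cf_ops(1))

lemma lie_subspace_sl_fr: "lie_subspace gl_cf (sl_fr :: 'k::field inf_mat set)"
  unfolding lie_subspace_def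
proof (intro conjI ballI allI)
  show "sl_fr \<subseteq> lie_carrier (gl_cf :: ('k, 'k inf_mat) lie_structure)"
    by (simp add: gl_cf_ops(1) sl_fr_range)
  have "entry (0 :: 'k colfin) \<in> sl_fr" by (rule entry_sl_frI[of "{}"]) (simp_all add: entry_simps)
  then show "lie_zero gl_cf \<in> (sl_fr :: 'k inf_mat set)" by (simp add: gl_cf_ops)
next
  fix x y :: "'k inf_mat" and c
  assume x: "x \<in> sl_fr"
  then obtain u where u: "x = entry u" using sl_fr_range by blast
  then show "lie_scale gl_cf c x \<in> sl_fr" using x by (simp add: gl_cf_ops sl_fr_scalar_mat)
  assume y: "y \<in> sl_fr"
  then obtain v where "y = entry v" using sl_fr_range by blast
  then show "lie_add gl_cf x y \<in> sl_fr" using x y u by (simp add: gl_cf_ops sl_fr_add)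
qed

section \<open>Single-row matrices generate the trace-zero matrices\<close>

lift_definition row_mat :: "nat \<Rightarrow> (nat \<Rightarrow> 'k::field) \<Rightarrow> 'k colfin" is
  "\<lambda>i \<phi> a b. if a = i then \<phi> b else 0"
  by (simp add: carrier_gl_cf)

abbreviation unit_mat :: "'k::field \<Rightarrow> nat \<Rightarrow> nat \<Rightarrow> 'k colfin" where
  "unit_mat c i j \<equiv> row_mat i (\<lambda>b. if b = j then c else 0)"

lemma entry_times_row: "entry (x * row_mat i \<phi>) a b = entry x a i * \<phi> b"
proof -
  have "entry (x * row_mat i \<phi>) a b = (\<Sum>k\<in>{i}. entry x a k * entry (row_mat i \<phi>) k b)"
    by (rule entry_times_sum) (auto simp: row_mat.rep_eq)
  then show ?thesis by (simp add: row_mat.rep_eq)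
qed

lemma entry_unit_times: "entry (unit_mat c i j * x) a b = (if a = i then c * entry x j b else 0)"
proof -
  let ?S = "insert j {k. entry x k b \<noteq> 0}"
  have "entry (unit_mat c i j * x) a b = (\<Sum>k\<in>?S. entry (unit_mat c i j) a k * entry x k b)"
    using finite_column by (intro entry_times_sum) auto
  also have "\<dots> = (\<Sum>k\<in>?S. if k = j then (if a = i then c * entry x k b else 0) else 0)"
    by (rule sum.cong) (auto simp: row_mat.rep_eq)
  also have "\<dots> = (if a = i then c * entry x j b else 0)"
    using finite_column by (subst sum.delta) auto
  finally show ?thesis .
qed

lemma row_times_row: "row_mat i \<phi> * row_mat j \<psi> = row_mat i (\<lambda>b. \<phi> j * \<psi> b)"
  by (rule colfin_eqI) (simp add: entry_times_row row_mat.rep_eq)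

lemma row_mat_zero: "row_mat i (\<lambda>b. 0) = 0"
  by (rule colfin_eqI) (simp add: row_mat.rep_eq entry_simps)

lemma row_mat_add: "row_mat i \<phi> + row_mat i \<psi> = row_mat i (\<lambda>b. \<phi> b + \<psi> b)"
  by (rule colfin_eqI) (simp add: row_mat.rep_eq entry_simps)

lemma row_mat_sl_fr: "\<phi> i = 0 \<Longrightarrow> entry (row_mat i \<phi>) \<in> sl_fr"
  by (rule entry_sl_frI[of "{i}"]) (auto simp: row_mat.rep_eq)

lemma entry_sum: "entry (\<Sum>s\<in>S. f s) i j = (\<Sum>s\<in>S. entry (f s) i j)"
  by (induction S rule: infinite_finite_induct) (simp_all add: entry_simps)

text \<open>
  The terms \<open>unit_mat (entry x i i) 0 0\<close> sum to the trace of \<open>x\<close> in position \<open>(0, 0)\<close>, hence to \<open>0\<close>; they are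
  inserted to make every summand traceless.
\<close>

lemma trace_zero_decomposition:
  assumes x: "entry x \<in> sl_fr"
  obtains S where "finite S"
    "x = (\<Sum>i\<in>S. row_mat i ((entry x i)(i := 0))
            + (unit_mat (entry x i i) i i - unit_mat (entry x i i) 0 0))"
proof -
  obtain S where S: "finite S" "\<And>i j. i \<notin> S \<Longrightarrow> entry x i j = 0" "(\<Sum>i\<in>S. entry x i i) = 0"
    using x by (auto simp: entry_sl_fr_iff)
  have "x = (\<Sum>i\<in>S. row_mat i ((entry x i)(i := 0))
            + (unit_mat (entry x i i) i i - unit_mat (entry x i i) 0 0))"
  proof (rule colfin_eqI)
    fix a b
    have "entry (\<Sum>i\<in>S. row_mat i ((entry x i)(i := 0))
          + (unit_mat (entry x i i) i i - unit_mat (entry x i i) 0 0)) a b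
      = (\<Sum>i\<in>S. (if i = a then entry x i b else 0) - (if a = 0 \<and> b = 0 then entry x i i else 0))"
      unfolding entry_sum by (rule sum.cong) (auto simp: entry_simps row_mat.rep_eq)
    also have "\<dots> = entry x a b - (if a = 0 \<and> b = 0 then \<Sum>i\<in>S. entry x i i else 0)"
      using S by (auto simp: sum_subtractf sum.delta)
    finally show "entry x a b = entry (\<Sum>i\<in>S. row_mat i ((entry x i)(i := 0))
          + (unit_mat (entry x i i) i i - unit_mat (entry x i i) 0 0)) a b"
      using S(3) by simp
  qed
  then show thesis using that S(1) by blast
qed

context
  fixes J :: "'k::field colfin set"
  assumes add: "\<And>x y. x \<in> J \<Longrightarrow> y \<in> J \<Longrightarrow> x + y \<in> J"
    and bracket: "\<And>x y. entry x \<in> sl_fr \<Longrightarrow> y \<in> J \<Longrightarrow> x * y - y * x \<in> J"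
begin

lemma bracket_sl_right: "entry x \<in> sl_fr \<Longrightarrow> y \<in> J \<Longrightarrow> y * x - x * y \<in> J"
  using bracket[of "-x" y] by (simp add: sl_fr_uminus)

text \<open>
  Let \<open>a\<close> have a nonzero entry at \<open>(p, q)\<close> and zero row \<open>l\<close>.  Then \<open>b = [a, e\<^sub>q\<^sub>l]\<close> is column \<open>q\<close> of \<open>a\<close> moved
  to position \<open>l\<close>, and bracketing \<open>b\<close> with \<open>e\<^sub>m\<^sub>p\<close> picks its entry in row \<open>p\<close>.  The conditions \<open>l \<noteq> q\<close> and
  \<open>m \<noteq> p\<close> make these matrix units traceless.
\<close>

lemma unit_mat_mem_trace_zero_ideal:
  assumes a: "a \<in> J" "entry a \<in> sl_fr" "a \<noteq> 0"
  obtains m l where "m \<noteq> l" "unit_mat 1 m l \<in> J"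
proof -
  obtain p q where pq: "entry a p q \<noteq> 0"
    using a(3) colfin_eqI[of a 0] by (auto simp: entry_simps)
  obtain S where S: "finite S" "\<And>i j. i \<notin> S \<Longrightarrow> entry a i j = 0"
    using a(2) by (auto simp: entry_sl_fr_iff)
  obtain l where l: "l \<notin> insert q S"
    using ex_new_if_finite[OF infinite_UNIV_nat] S(1) by blast
  obtain m where m: "m \<notin> {p, l}"
    using ex_new_if_finite[OF infinite_UNIV_nat, of "{p, l}"] by blast
  define b where "b = a * unit_mat 1 q l - unit_mat 1 q l * a"
  have b: "b \<in> J"
    unfolding b_def using l a by (intro bracket_sl_right row_mat_sl_fr) auto
  have b_entry: "entry b i j = (if j = l then entry a i q else 0)" for i j
    using l S(2)[of l j] by (auto simp: b_def entry_minus entry_times_row entry_unit_times)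
  let ?e = "unit_mat (inverse (entry a p q)) m p"
  have "?e * b - b * ?e \<in> J" using m b by (intro bracket row_mat_sl_fr) auto
  moreover have "?e * b - b * ?e = unit_mat 1 m l"
    using m pq by (intro colfin_eqI)
      (auto simp: entry_minus entry_times_row entry_unit_times b_entry row_mat.rep_eq)
  ultimately show thesis using that m by auto
qed

text \<open>
  Bracketing \<open>e\<^sub>m\<^sub>l\<close> with a matrix supported on row \<open>l\<close> moves that row to row \<open>m\<close>, provided that its
  entry in column \<open>m\<close> vanishes; the condition that it vanishes in column \<open>l\<close> is removed by \<open>extend\<close>.
  The same two steps lead from row \<open>m\<close> to any other row \<open>i\<close>.
\<close>

lemma row_mat_mem_trace_zero_ideal:
  assumes ml: "m \<noteq> l" "unit_mat 1 m l \<in> J" and \<phi>: "\<phi> i = 0"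
  shows "row_mat i \<phi> \<in> J"
proof -
  have times: "row_mat i \<psi> * row_mat j \<chi> - row_mat j \<chi> * row_mat i \<psi> \<in> J"
    if "row_mat i \<psi> \<in> J" "\<chi> j = 0" for i j \<psi> \<chi>
    using that by (intro bracket_sl_right row_mat_sl_fr)
  have times': "row_mat j \<chi> * row_mat i \<psi> - row_mat i \<psi> * row_mat j \<chi> \<in> J"
    if "row_mat i \<psi> \<in> J" "\<chi> j = 0" for i j \<psi> \<chi>
    using that by (intro bracket row_mat_sl_fr)
  have fresh: "\<exists>k. k \<noteq> i \<and> k \<noteq> j" for i j :: nat
    using ex_new_if_finite[OF infinite_UNIV_nat, of "{i, j}"] by auto
  \<comment> \<open>The entry in column \<open>j\<close> is supplied by \<open>[e\<^sub>i\<^sub>k, c e\<^sub>k\<^sub>j] = c e\<^sub>i\<^sub>j\<close> for a third index \<open>k\<close>.\<close>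
  have extend: "row_mat i \<psi> \<in> J"
    if vanish: "\<And>\<chi>. \<chi> i = 0 \<Longrightarrow> \<chi> j = 0 \<Longrightarrow> row_mat i \<chi> \<in> J" and "i \<noteq> j" "\<psi> i = 0" for i j \<psi>
  proof -
    obtain k where k: "k \<noteq> i" "k \<noteq> j" using fresh by blast
    have "unit_mat 1 i k \<in> J" using k by (intro vanish) auto
    from times[OF this, of "\<lambda>b. if b = j then \<psi> j else 0" k]
    have "unit_mat (\<psi> j) i j \<in> J"
      using k \<open>i \<noteq> j\<close> by (simp add: row_times_row row_mat_zero cong: if_cong)
    moreover have "row_mat i (\<psi>(j := 0)) \<in> J" using that by (intro vanish) auto
    ultimately have "row_mat i (\<psi>(j := 0)) + unit_mat (\<psi> j) i j \<in> J" by (rule add[rotated])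
    also have "row_mat i (\<psi>(j := 0)) + unit_mat (\<psi> j) i j = row_mat i \<psi>"
      unfolding row_mat_add by (rule arg_cong[where f = "row_mat i"]) auto
    finally show ?thesis .
  qed
  have "row_mat m \<psi> \<in> J" if "\<psi> m = 0" "\<psi> l = 0" for \<psi>
    using times[OF ml(2), of \<psi> l] that by (simp add: row_times_row row_mat_zero)
  then have m: "row_mat m \<psi> \<in> J" if "\<psi> m = 0" for \<psi>
    using extend ml(1) that by blast
  show ?thesis
  proof (cases "i = m")
    case False
    have "row_mat i \<psi> \<in> J" if "\<psi> i = 0" "\<psi> m = 0" for \<psi>
      using times'[OF m, of \<psi> "\<lambda>b. if b = m then 1 else 0" i] that False
      by (simp add: row_times_row row_mat_zero)
    then show ?thesis using extend False \<phi> by blast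
  qed (use m \<phi> in blast)
qed

lemma trace_zero_ideal_contains_sl_fr:
  assumes a: "a \<in> J" "entry a \<in> sl_fr" "a \<noteq> 0" and x: "entry x \<in> sl_fr"
  shows "x \<in> J"
proof -
  obtain m l where "m \<noteq> l" "unit_mat 1 m l \<in> J"
    by (rule unit_mat_mem_trace_zero_ideal[OF a])
  then have row: "row_mat i \<phi> \<in> J" if "\<phi> i = 0" for i \<phi>
    using row_mat_mem_trace_zero_ideal that by blast
  have zero: "0 \<in> J" using bracket[OF a(2,1)] by simp
  have diag: "unit_mat c i i - unit_mat c 0 0 \<in> J" for c i
  proof (cases "i = 0")
    case False
    then have "unit_mat 1 i 0 * unit_mat c 0 i - unit_mat c 0 i * unit_mat 1 i 0 \<in> J"
      by (intro bracket_sl_right row row_mat_sl_fr) auto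
    then show ?thesis by (simp add: row_times_row if_distrib[of "(*) c"] cong: if_cong)
  qed (simp add: zero)
  have sum: "(\<Sum>i\<in>S. f i) \<in> J" if "finite S" "\<And>i. f i \<in> J" for S and f :: "nat \<Rightarrow> 'k colfin"
    using that by (induction S rule: finite_induct) (auto intro: zero add)
  obtain S where S: "finite S" and "x = (\<Sum>i\<in>S. row_mat i ((entry x i)(i := 0))
            + (unit_mat (entry x i i) i i - unit_mat (entry x i i) 0 0))"
    by (rule trace_zero_decomposition[OF x])
  moreover have "(\<Sum>i\<in>S. row_mat i ((entry x i)(i := 0))
            + (unit_mat (entry x i i) i i - unit_mat (entry x i i) 0 0)) \<in> J"
    by (intro sum S add row diag) simp
  ultimately show ?thesis by metis
qed

end

lemma simple_sl_fr: "simple_lie_algebra (lie_restrict gl_cf (sl_fr :: 'k::field inf_mat set))"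
  (is "simple_lie_algebra ?L")
proof -
  interpret lie_algebra "gl_cf :: ('k, 'k inf_mat) lie_structure" by (rule lie_algebra_gl_cf)
  have ops: "lie_carrier ?L = sl_fr" "lie_zero ?L = entry 0"
    "lie_add ?L (entry x) (entry y) = entry (x + y)"
    "lie_bracket ?L (entry x) (entry y) = entry (x * y - y * x)" for x y
    by (simp_all add: lie_restrict_def gl_cf_ops)
  have "lie_algebra ?L"
  proof (rule lie_algebra_restrict[OF lie_subspace_sl_fr])
    fix x y :: "'k inf_mat"
    assume xy: "x \<in> sl_fr" "y \<in> sl_fr"
    then obtain u v where "x = entry u" "y = entry v" using sl_fr_range by blast
    then show "lie_bracket gl_cf x y \<in> sl_fr" using xy by (simp add: gl_cf_ops sl_fr_commutator)
  qed
  moreover have "\<exists>x\<in>lie_carrier ?L. \<exists>y\<in>lie_carrier ?L. lie_bracket ?L x y \<noteq> lie_zero ?L"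
  proof -
    let ?x = "unit_mat 1 0 1 :: 'k colfin" and ?y = "unit_mat 1 1 0 :: 'k colfin"
    have "entry (?x * ?y - ?y * ?x) 0 0 \<noteq> entry 0 0 0"
      by (simp add: entry_minus row_times_row row_mat.rep_eq entry_simps)
    then have "lie_bracket ?L (entry ?x) (entry ?y) \<noteq> lie_zero ?L"
      unfolding ops by metis
    moreover have "entry ?x \<in> sl_fr" "entry ?y \<in> sl_fr" by (auto intro: row_mat_sl_fr)
    ultimately show ?thesis unfolding ops(1) by blast
  qed
  moreover have "I = {lie_zero ?L} \<or> I = lie_carrier ?L" if I: "lie_ideal ?L I" for I
  proof -
    have sub: "I \<subseteq> sl_fr" and zero: "lie_zero ?L \<in> I"
      and add: "\<And>x y. x \<in> I \<Longrightarrow> y \<in> I \<Longrightarrow> lie_add ?L x y \<in> I"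
      and br: "\<And>x y. x \<in> sl_fr \<Longrightarrow> y \<in> I \<Longrightarrow> lie_bracket ?L x y \<in> I"
      using I by (auto simp: lie_ideal_def lie_subspace_def ops)
    show ?thesis
    proof (cases "I \<subseteq> {lie_zero ?L}")
      case False
      then obtain a where a: "entry a \<in> I" "entry a \<noteq> entry 0"
        using sub sl_fr_range unfolding ops by blast
      have "x \<in> entry -` I" if "entry x \<in> sl_fr" for x
      proof (rule trace_zero_ideal_contains_sl_fr[OF _ _ _ _ _ that])
        show "u + v \<in> entry -` I" if "u \<in> entry -` I" "v \<in> entry -` I" for u v
          using add[of "entry u" "entry v"] that by (simp add: ops)
        show "u * v - v * u \<in> entry -` I" if "entry u \<in> sl_fr" "v \<in> entry -` I" for u v
          using br[of "entry u" "entry v"] that by (simp add: ops)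
        show "a \<in> entry -` I" "entry a \<in> sl_fr" "a \<noteq> 0" using a sub by auto
      qed
      then have "sl_fr \<subseteq> I" using sl_fr_range by blast
      then show ?thesis using sub by (simp add: ops)
    qed (use zero in blast)
  qed
  ultimately show ?thesis unfolding simple_lie_algebra_def by blast
qed

theorem corollary1p2:
  "simple_lie_algebra (lie_restrict gl_cf (sl_fr :: 'k::field inf_mat set)) \<and>
   simple_lie_algebra
     (lie_quotient gl_cf (lie_sum gl_cf d_sc gl_fr :: 'k::field inf_mat set))"
  by (intro conjI simple_sl_fr simple_quotient_gl_cf)

end
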